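(* Let $(M,0)$ be a real $\mathcal{C}^1$-smooth hypersurface germ at $0\in\mathbb{C}^2$ defined by the equation $$\rho(z_1,z_2):=\mathrm{Re}\,z_1+P(z_2)+(\mathrm{Im}\,z_1)\,Q(z_2,\mathrm{Im}\,z_1)=0,$$ where $P$ and $Q$ are real-valued functions defined near $0\in\mathbb{C}$ and near $(0,0)\in\mathbb{C}\times\mathbb{R}$ respectively, satisfying: (1) $P,Q$ are $\mathcal{C}^1$-smooth with $P(0)=Q(0,0)=0$; (2) $P(z_2)=P(|z_2|)$ and $Q(z_2,t)=Q(|z_2|,t)$ for any $z_2$ and $t$; (3) $P(z_2)>0$ for any $z_2\neq 0$; (4) $P(z_2)$ and $P'(z_2)$ are flat at $z_2=0$. Then $\mathrm{hol}_0(M,0)=\big\{i\beta z_2\frac{\partial}{\partial z_2}:\beta\in\mathbb{R}\big\}$.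
   Context: For a real $\mathcal{C}^1$-smooth hypersurface germ $(M,p)$ in $\mathbb{C}^n$, a holomorphic vector field germ $(H,p)$ is tangent to $M$ if $\mathrm{Re}\,H$ is tangent to $M$; for $M=\{\rho=0\}$ this means $(\mathrm{Re}\,H)\rho=0$ at all points of $M$ near $p$. For $n=2$, $p=0$ and $H=h_1\frac{\partial}{\partial z_1}+h_2\frac{\partial}{\partial z_2}$, this reads $\mathrm{Re}\big[h_1\rho_{z_1}+h_2\rho_{z_2}\big]=0$ on $M$ near $0$. $\mathrm{hol}_0(M,p)$ denotes the real vector space of holomorphic vector field germs $(H,p)$ vanishing at $p$ which are tangent to $M$. $P'(z)=P_z(z)=\frac{\partial P}{\partial z}(z)$ is the Wirtinger derivative. A complex-valued function $f$ defined near $0\in\mathbb{C}$ (no smoothness required) is flat at $0$ if for each $n\in\mathbb{N}$ there exist $C,\epsilon>0$ (depending on $n$) with $|f(z)|\le C|z|^n$ for all $|z|<\epsilon$. *)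

theory Defs
  imports "HOL-Analysis.Analysis"
begin

definition C1_near :: "('a::real_normed_vector \<Rightarrow> 'b::real_normed_vector) \<Rightarrow> 'a \<Rightarrow> bool" where
  "C1_near f x \<longleftrightarrow>
     (\<exists>U (f' :: 'a \<Rightarrow> 'a \<Rightarrow>\<^sub>L 'b). open U \<and> x \<in> U \<and>
        (\<forall>y\<in>U. (f has_derivative blinfun_apply (f' y)) (at y)) \<and> continuous_on U f')"

text \<open>The Wirtinger derivative \<open>f\<^sub>z = (f\<^sub>x - \<i> f\<^sub>y) / 2\<close>; the real Frechet derivative at
  \<open>z\<close> sends \<open>1\<close> to \<open>f\<^sub>x\<close> and \<open>\<i>\<close> to \<open>f\<^sub>y\<close>.\<close>

definition wirtinger :: "(complex \<Rightarrow> complex) \<Rightarrow> complex \<Rightarrow> complex" where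
  "wirtinger f z = (frechet_derivative f (at z) 1 - \<i> * frechet_derivative f (at z) \<i>) / 2"

definition wirtinger1 :: "(complex \<times> complex \<Rightarrow> real) \<Rightarrow> complex \<times> complex \<Rightarrow> complex" where
  "wirtinger1 \<rho> z = wirtinger (\<lambda>w. of_real (\<rho> (w, snd z))) (fst z)"

definition wirtinger2 :: "(complex \<times> complex \<Rightarrow> real) \<Rightarrow> complex \<times> complex \<Rightarrow> complex" where
  "wirtinger2 \<rho> z = wirtinger (\<lambda>w. of_real (\<rho> (fst z, w))) (snd z)"

definition flat_at_0 :: "(complex \<Rightarrow> complex) \<Rightarrow> bool" where
  "flat_at_0 f \<longleftrightarrow>
     (\<forall>n::nat. \<exists>C>0. \<exists>\<epsilon>>0. \<forall>z. norm z < \<epsilon> \<longrightarrow> norm (f z) \<le> C * norm z ^ n)"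

text \<open>Holomorphy in two variables: the real derivative exists at every point and is
  complex linear.\<close>

definition holomorphic2_on :: "(complex \<times> complex \<Rightarrow> complex) \<Rightarrow> (complex \<times> complex) set \<Rightarrow> bool" where
  "holomorphic2_on f U \<longleftrightarrow>
     (\<forall>z\<in>U. \<exists>a b. (f has_derivative (\<lambda>v. a * fst v + b * snd v)) (at z))"

text \<open>A vector field \<open>h\<^sub>1 \<partial>/\<partial>z\<^sub>1 + h\<^sub>2 \<partial>/\<partial>z\<^sub>2\<close> is represented by the map \<open>z \<mapsto> (h\<^sub>1 z, h\<^sub>2 z)\<close>.\<close>

type_synonym vfield = "complex \<times> complex \<Rightarrow> complex \<times> complex"

definition holomorphic_vfield_near :: "vfield \<Rightarrow> complex \<times> complex \<Rightarrow> bool" where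
  "holomorphic_vfield_near H p \<longleftrightarrow>
     (\<exists>U. open U \<and> p \<in> U \<and> holomorphic2_on (\<lambda>z. fst (H z)) U \<and> holomorphic2_on (\<lambda>z. snd (H z)) U)"

text \<open>The germ of \<open>H\<close> at \<open>p\<close>, as the class of all maps agreeing with \<open>H\<close> near \<open>p\<close>.\<close>

definition vfield_germ :: "complex \<times> complex \<Rightarrow> vfield \<Rightarrow> vfield set" where
  "vfield_germ p H = {G. \<forall>\<^sub>F z in nhds p. G z = H z}"

text \<open>Tangency at \<open>p\<close> to the hypersurface \<open>{\<rho> = 0}\<close>: with \<open>Re H = (H + cnj H) / 2\<close> and
  \<open>\<rho>\<close> real, \<open>(Re H) \<rho> = Re (H \<rho>)\<close>.\<close>

definition tangent_near :: "vfield \<Rightarrow> (complex \<times> complex \<Rightarrow> real) \<Rightarrow> complex \<times> complex \<Rightarrow> bool" where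
  "tangent_near H \<rho> p \<longleftrightarrow>
     (\<forall>\<^sub>F z in nhds p. \<rho> z = 0 \<longrightarrow>
        Re (fst (H z) * wirtinger1 \<rho> z + snd (H z) * wirtinger2 \<rho> z) = 0)"

text \<open>The hypersurface germ \<open>(M, p)\<close>, \<open>M = {\<rho> = 0}\<close>, is given through its defining function \<open>\<rho>\<close>.\<close>

definition hol0 :: "(complex \<times> complex \<Rightarrow> real) \<Rightarrow> complex \<times> complex \<Rightarrow> vfield set set" where
  "hol0 \<rho> p = {vfield_germ p H |H.
     holomorphic_vfield_near H p \<and> H p = 0 \<and> tangent_near H \<rho> p}"

end

theory Submission
  imports Defs "HOL-Complex_Analysis.Complex_Analysis"
begin

text \<open>
  Write \<open>t = Im z\<^sub>1\<close>, \<open>r = \<bar>z\<^sub>2\<bar>\<close> and \<open>p r = P r\<close>. By radial symmetry, \<open>S = 2 z\<^sub>2 \<rho>\<^bsub>z2\<^esub>\<close> is a real function of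
  \<open>(r, t)\<close>, which shows at once that the rotations \<open>\<i> \<beta> z\<^sub>2 \<partial>/\<partial>z\<^sub>2\<close> are tangent. Also \<open>D = 2 \<rho>\<^bsub>z1\<^esub>\<close> depends on \<open>(r, t)\<close>
  only and tends to \<open>1\<close> at the origin. Conversely, let \<open>H = (h\<^sub>1, h\<^sub>2)\<close> be tangent and vanish at \<open>0\<close>. Fix \<open>(r, t)\<close>,
  hence the value of \<open>z\<^sub>1\<close> on the hypersurface. Tangency says that the holomorphic function
  \<open>\<phi> z\<^sub>2 = z\<^sub>2 h\<^sub>1 D + h\<^sub>2 S\<close> of \<open>z\<^sub>2\<close> satisfies \<open>Re (\<phi> z\<^sub>2 / z\<^sub>2) = 0\<close> on the circle \<open>\<bar>z\<^sub>2\<bar> = r\<close>. By the maximum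
  principle (\<open>quadratic_of_Re_zero_on_circle\<close>) this forces
  \<open>\<phi> z\<^sub>2 = \<phi> 0 + \<i> k z\<^sub>2 - cnj (\<phi> 0) z\<^sub>2\<^sup>2 / r\<^sup>2\<close> with \<open>k\<close> real, on the entire disc on which \<open>h\<^sub>1\<close> and \<open>h\<^sub>2\<close> are
  defined. This takes the place of an expansion of \<open>H\<close> into terms homogeneous under rotations of \<open>z\<^sub>2\<close>.

  With \<open>z\<^sub>2\<close> now fixed, one lets \<open>r \<rightarrow> 0\<close> along the curves \<open>t = \<alpha> p r\<close>, on which
  \<open>z\<^sub>1 = (\<i> \<alpha> - 1 + o(1)) p\<close> and \<open>S = r p' + o(p)\<close>, and compares orders of vanishing in \<open>z\<^sub>1\<close>. Three facts on \<open>p\<close>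
  enter: \<open>p = o(r\<^sup>n)\<close> for all \<open>n\<close>; \<open>r p' / p\<close> is unbounded, because otherwise \<open>p\<close> would decay no
  faster than a power of \<open>r\<close> (\<open>log_derivative_unbounded\<close>); and \<open>p' = O(r\<^sup>2)\<close>. First, the quadratic term of \<open>\<phi>\<close>
  yields \<open>h\<^sub>2(z\<^sub>1, 0) = 0\<close> (\<open>rotating_term_vanishes\<close>). Then \<open>\<phi> z\<^sub>2 = \<i> k z\<^sub>2\<close>, and the limit \<open>r \<rightarrow> 0\<close> yields
  \<open>h\<^sub>1(0, z\<^sub>2) = 0\<close>. Finally \<open>Re (h\<^sub>1 D + (h\<^sub>2 / z\<^sub>2) S) = 0\<close> along all these curves. If \<open>h\<^sub>1\<close> dominates, the leading
  coefficient gives \<open>Re (a (\<i> \<alpha> - 1)\<^sup>l) = 0\<close> for all real \<open>\<alpha>\<close>, with \<open>l \<ge> 1\<close> and \<open>a \<noteq> 0\<close>, which is absurd; if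
  \<open>h\<^sub>2 / z\<^sub>2\<close> minus an imaginary constant dominates, then \<open>r p' / p\<close> is bounded. Hence \<open>h\<^sub>1 = 0\<close>, and \<open>h\<^sub>2 / z\<^sub>2\<close> is an
  imaginary constant for each \<open>z\<^sub>2\<close> (\<open>Re_tangency_rigidity\<close>); as \<open>\<phi> z\<^sub>2 / z\<^sub>2\<close> does not depend on \<open>z\<^sub>2\<close> and \<open>S\<close> is
  not identically zero, this constant is the same for all \<open>z\<^sub>2\<close>.
\<close>

section \<open>Holomorphic functions of one variable\<close>

lemma holomorphic_zero_or_order:
  assumes "f holomorphic_on ball 0 R" "R > 0"
  shows "(\<forall>w\<in>ball 0 R. f w = 0) \<or>
    (\<exists>n g. isCont g 0 \<and> g 0 \<noteq> 0 \<and> (\<forall>\<^sub>F w in nhds 0. f w = w ^ n * g w))"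
proof (cases "\<forall>w\<in>ball 0 R. f w = 0")
  case False
  define g where "g = zor_poly f 0"
  obtain r where r: "r > 0" "g holomorphic_on cball 0 r"
      "\<forall>w\<in>cball 0 r. f w = g w * (w - 0) ^ nat (zorder f 0) \<and> g w \<noteq> 0"
    using zorder_exist_zero [OF assms(1) open_ball connected_ball, of 0] False assms(2)
    unfolding g_def by (auto split: if_splits)
  have "isCont g 0"
    using continuous_on_interior [OF holomorphic_on_imp_continuous_on [OF r(2)], of 0] r(1)
    by auto
  moreover have "\<forall>\<^sub>F w in nhds 0. f w = w ^ nat (zorder f 0) * g w"
    using eventually_nhds_in_open [of "ball 0 r" 0] r by (auto elim!: eventually_mono)
  moreover have "g 0 \<noteq> 0" using r by auto
  ultimately show ?thesis by blast
qed simp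

lemma imaginary_holomorphic_constant:
  assumes f: "f holomorphic_on ball 0 R" and r: "0 < r" "r < R"
    and re: "\<And>z. norm z = r \<Longrightarrow> Re (f z) = 0"
  shows "\<exists>k::real. \<forall>z\<in>ball 0 R. f z = \<i> * of_real k"
proof -
  have sub: "cball 0 r \<subseteq> ball 0 R" using r by auto
  have cont: "continuous_on (cball 0 r) f"
    using f sub holomorphic_on_imp_continuous_on holomorphic_on_subset by blast
  have hol: "f holomorphic_on ball 0 r"
    using f sub by (meson ball_subset_cball holomorphic_on_subset order_trans)
  have "Re (f z) \<le> 0" if "z \<in> cball 0 r" for z
    by (rule maximum_real_frontier [of f "cball 0 r"]) (use cont hol re r that in auto)
  moreover have "Re (- f z) \<le> 0" if "z \<in> cball 0 r" for z
    by (rule maximum_real_frontier [of "\<lambda>z. - f z" "cball 0 r"])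
      (use cont hol re r that in \<open>auto intro!: holomorphic_intros continuous_intros\<close>)
  ultimately have re0: "Re (f z) = 0" if "z \<in> cball 0 r" for z
    using that by force
  \<comment> \<open>the image of the small disc lies in a line, hence is not open\<close>
  have "f constant_on ball 0 R"
  proof (rule ccontr)
    assume "\<not> f constant_on ball 0 R"
    then have "open (f ` ball 0 r)"
      using r by (intro open_mapping_thm [OF f open_ball connected_ball open_ball]) auto
    then obtain e where e: "e > 0" "ball (f 0) e \<subseteq> f ` ball 0 r"
      using r by (metis centre_in_ball image_eqI open_contains_ball)
    have "f 0 + of_real (e/2) \<in> ball (f 0) e" using e by (simp add: dist_norm)
    then obtain z where "z \<in> ball 0 r" "f z = f 0 + of_real (e/2)" using e by fastforce
    then show False using re0 [of z] re0 [of 0] e r by auto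
  qed
  then obtain c where c: "\<And>z. z \<in> ball 0 R \<Longrightarrow> f z = c" unfolding constant_on_def by auto
  have "Re c = 0" using re0 [of 0] c [of 0] r by auto
  then show ?thesis using c by (intro exI [of _ "Im c"]) (auto simp: complex_eq_iff)
qed

text \<open>
  Since \<open>1 / z = cnj z / r\<^sup>2\<close> on the circle, the pole of \<open>f z / z\<close> at \<open>0\<close> can be removed, without changing the
  real part on the circle, by adding \<open>cnj (f 0) z / r\<^sup>2\<close>. What results is an imaginary constant.
\<close>
lemma quadratic_of_Re_zero_on_circle:
  assumes f: "f holomorphic_on ball 0 R" and r: "0 < r" "r < R"
    and re: "\<And>z. norm z = r \<Longrightarrow> Re (f z / z) = 0"
  shows "\<exists>k::real. \<forall>z\<in>ball 0 R.
    f z = f 0 + \<i> * of_real k * z - cnj (f 0) * z\<^sup>2 / of_real (r\<^sup>2)"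
proof -
  define g where "g z = (if z = 0 then deriv f 0 else (f z - f 0) / (z - 0)) +
    cnj (f 0) * z / of_real (r\<^sup>2)" for z
  have g: "g holomorphic_on ball 0 R"
    unfolding g_def using pole_lemma_open [OF f open_ball, of 0] r
    by (intro holomorphic_intros) auto
  have "Re (g z) = 0" if z: "norm z = r" for z
  proof -
    have nz: "z \<noteq> 0" using z r by auto
    \<comment> \<open>the two corrections are conjugate to each other, up to the sign\<close>
    have "f 0 / z = f 0 * cnj z / of_real (r\<^sup>2)"
      using nz z complex_norm_square [of z] by (simp add: divide_simps power2_eq_square)
    then have "g z = f z / z + (cnj (f 0 * cnj z / of_real (r\<^sup>2)) - f 0 * cnj z / of_real (r\<^sup>2))"
      using nz by (simp add: g_def diff_divide_distrib)
    then show ?thesis using re [OF z] by simp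
  qed
  then obtain k where k: "\<And>z. z \<in> ball 0 R \<Longrightarrow> g z = \<i> * of_real k"
    using imaginary_holomorphic_constant [OF g r] by auto
  have "f z = f 0 + \<i> * of_real k * z - cnj (f 0) * z\<^sup>2 / of_real (r\<^sup>2)"
    if z: "z \<in> ball 0 R" for z
  proof (cases "z = 0")
    case False
    have "f z = f 0 + g z * z - cnj (f 0) * z\<^sup>2 / of_real (r\<^sup>2)"
      using False r by (simp add: g_def field_simps power2_eq_square)
    then show ?thesis using k [OF z] by simp
  qed simp
  then show ?thesis by blast
qed

text \<open>
  The argument of \<open>(\<i> \<alpha> - 1) ^ n\<close> varies with \<open>\<alpha>\<close> unless \<open>n = 0\<close>, so that a multiple of it cannot stay
  imaginary.
\<close>
lemma Re_power_nonzero: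
  fixes c :: complex
  assumes c: "c \<noteq> 0" and "n \<noteq> 0 \<or> Re c \<noteq> 0"
  shows "\<exists>\<alpha>::real. Re (c * (\<i> * of_real \<alpha> - 1) ^ n) \<noteq> 0"
proof (cases "Re c = 0")
  case False
  then show ?thesis by (intro exI [of _ 0]) (auto simp: minus_one_power_iff)
next
  case True
  with assms have n: "n \<noteq> 0" and d: "c = \<i> * of_real (Im c)" "Im c \<noteq> 0"
    by (auto simp: complex_eq_iff)
  \<comment> \<open>With \<open>\<alpha> = - tan t\<close> the power has the argument \<open>n t\<close>, up to the sign. The choice \<open>n t = pi / 3\<close>
    keeps \<open>t\<close> below \<open>pi / 2\<close> for all \<open>n \<ge> 1\<close>.\<close>
  define t where "t = pi / (3 * real n)"
  have t: "0 < t" "t < pi / 2" "real n * t = pi / 3"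
    using n by (auto simp: t_def field_simps)
  then have cs: "cos t > 0" by (intro cos_gt_zero) auto
  have "\<i> * of_real (- tan t) - 1 = - cis t / of_real (cos t)"
    using cs by (simp add: complex_eq_iff tan_def)
  then have "(\<i> * of_real (- tan t) - 1) ^ n = (-1) ^ n * cis (pi / 3) / of_real (cos t ^ n)"
    using t by (simp only: power_divide power_minus [of "cis t"] Complex.DeMoivre of_real_power)
  then have "c * (\<i> * of_real (- tan t) - 1) ^ n =
      of_real (Im c * (-1) ^ n / cos t ^ n) * (\<i> * cis (pi / 3))"
    by (subst d(1)) simp
  also have "Re \<dots> \<noteq> 0"
    using d cs by (simp add: sin_60)
  finally show ?thesis by blast
qed

section \<open>Flat radial profiles\<close>

text \<open>
  The radial profile \<open>p\<close> of a positive function that is flat at \<open>0\<close>, with derivative \<open>p'\<close>. The derivative is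
  only required to be \<open>O(r\<^sup>2)\<close>.
\<close>
locale flat_profile =
  fixes p p' :: "real \<Rightarrow> real"
  assumes deriv: "\<forall>\<^sub>F r in at_right 0. (p has_real_derivative p' r) (at r)"
    and pos: "\<forall>\<^sub>F r in at_right 0. p r > 0"
    and flat: "\<And>n::nat. \<exists>C. \<forall>\<^sub>F r in at_right 0. p r \<le> C * r ^ n"
    and flat': "\<exists>C. \<forall>\<^sub>F r in at_right 0. \<bar>p' r\<bar> \<le> C * r ^ 2"
begin

text \<open>
  This is how the flatness of \<open>p\<close> is mostly used: were \<open>r \<bar>p'\<bar> \<le> n p\<close>, then \<open>p r / r ^ n\<close> would be
  nonincreasing, so that \<open>p\<close> would not decay faster than \<open>r ^ n\<close>.
\<close>
lemma log_derivative_unbounded: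
  "\<not> (\<forall>\<^sub>F r in at_right 0. r * \<bar>p' r\<bar> \<le> C * p r)"
proof
  assume bd: "\<forall>\<^sub>F r in at_right 0. r * \<bar>p' r\<bar> \<le> C * p r"
  obtain n where n: "C \<le> real n" using real_arch_simple by blast
  from bd deriv pos have "\<forall>\<^sub>F r in at_right 0.
      (p has_real_derivative p' r) (at r) \<and> p r > 0 \<and> r * \<bar>p' r\<bar> \<le> C * p r"
    by eventually_elim auto
  then obtain d where d: "d > 0" and D: "\<And>r. 0 < r \<Longrightarrow> r < d \<Longrightarrow>
      (p has_real_derivative p' r) (at r) \<and> p r > 0 \<and> r * \<bar>p' r\<bar> \<le> C * p r"
    unfolding eventually_at_right_field by auto
  \<comment> \<open>the logarithm of \<open>p x / x ^ n\<close>\<close>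
  define f where "f x = ln (p x) - real n * ln x" for x
  define s where "s = d / 2"
  have lower: "exp (f s) * r ^ n \<le> p r" if r: "0 < r" "r < s" for r
  proof -
    have "f r \<ge> f s"
    proof (rule DERIV_nonpos_imp_nonincreasing [of r s f])
      fix x assume x: "r \<le> x" "x \<le> s"
      then have x': "0 < x" "x < d" using r d by (auto simp: s_def)
      note Dx = D [OF x']
      have "(f has_real_derivative (p' x / p x - real n / x)) (at x)"
        unfolding f_def using Dx x' by (auto intro!: derivative_eq_intros)
      moreover have "p' x / p x - real n / x \<le> 0"
      proof -
        have "x * p' x \<le> x * \<bar>p' x\<bar>" using x' by simp
        also have "\<dots> \<le> C * p x" using Dx by simp
        also have "\<dots> \<le> real n * p x" using n Dx by (intro mult_right_mono) auto
        finally show ?thesis using Dx x' by (simp add: field_simps)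
      qed
      ultimately show "\<exists>y. (f has_real_derivative y) (at x) \<and> y \<le> 0" by blast
    qed (use r in auto)
    then have "exp (f s) * r ^ n \<le> exp (f r) * r ^ n" using r by (simp add: mult_right_mono)
    also have "exp (f r) * r ^ n = p r"
      using D [of r] r d by (simp add: f_def exp_diff exp_of_nat_mult s_def)
    finally show ?thesis .
  qed
  obtain K where K: "\<forall>\<^sub>F r in at_right 0. p r \<le> K * r ^ Suc n" using flat by blast
  have "((\<lambda>r. K * r) \<longlongrightarrow> K * 0) (at_right 0)" by (intro tendsto_intros)
  then have "\<forall>\<^sub>F r in at_right 0. K * r < exp (f s)" by (rule order_tendstoD) simp
  moreover have "\<forall>\<^sub>F r in at_right 0. 0 < r \<and> r < s"
    using d by (auto simp: eventually_at_right_field s_def intro!: exI [of _ "d/2"])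
  ultimately have "\<forall>\<^sub>F r in at_right (0::real). False"
    using K
  proof eventually_elim
    case (elim r)
    have "exp (f s) * r ^ n \<le> K * r ^ Suc n" using lower [of r] elim by linarith
    then have "exp (f s) * r ^ n \<le> (K * r) * r ^ n" by simp
    then have "exp (f s) \<le> K * r" using elim by (simp add: mult_le_cancel_right)
    then show False using elim by simp
  qed
  then show False by (simp add: eventually_False)
qed

lemma pos_r: "\<forall>\<^sub>F r in at_right (0::real). r > 0"
  by (simp add: eventually_at_right_less)

lemma p_over_power: "((\<lambda>r. p r / r ^ n) \<longlongrightarrow> 0) (at_right 0)"
proof -
  obtain C where C: "\<forall>\<^sub>F r in at_right 0. p r \<le> C * r ^ Suc n" using flat by blast
  show ?thesis
  proof (rule tendsto_sandwich [of "\<lambda>_. 0" _ _ "\<lambda>r. C * r"])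
    show "\<forall>\<^sub>F r in at_right 0. 0 \<le> p r / r ^ n"
      using pos pos_r by eventually_elim simp
    show "\<forall>\<^sub>F r in at_right 0. p r / r ^ n \<le> C * r"
      using C pos_r by eventually_elim (simp add: field_simps)
    have "((\<lambda>r. C * r) \<longlongrightarrow> C * 0) (at_right 0)" by (intro tendsto_intros)
    then show "((\<lambda>r. C * r) \<longlongrightarrow> 0) (at_right 0)" by simp
  qed auto
qed

lemma p_tendsto_0: "(p \<longlongrightarrow> 0) (at_right 0)"
  using p_over_power [of 0] by simp

lemma rp'_tendsto_0: "((\<lambda>r. r * p' r) \<longlongrightarrow> 0) (at_right 0)"
proof -
  obtain C where C: "\<forall>\<^sub>F r in at_right 0. \<bar>p' r\<bar> \<le> C * r ^ 2" using flat' by blast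
  show ?thesis
  proof (rule Lim_null_comparison [of _ "\<lambda>r. C * r ^ 3"])
    show "\<forall>\<^sub>F r in at_right 0. norm (r * p' r) \<le> C * r ^ 3"
      using C pos_r
    proof eventually_elim
      case (elim r)
      then have "r * \<bar>p' r\<bar> \<le> r * (C * r^2)" by (intro mult_left_mono) auto
      then show ?case using elim by (simp add: abs_mult power2_eq_square power3_eq_cube mult_ac)
    qed
    have "((\<lambda>r. C * r ^ 3) \<longlongrightarrow> C * 0 ^ 3) (at_right 0)" by (intro tendsto_intros)
    then show "((\<lambda>r. C * r ^ 3) \<longlongrightarrow> 0) (at_right 0)" by simp
  qed
qed

lemma p'_not_eventually_0: "\<not> (\<forall>\<^sub>F r in at_right 0. p' r = 0)"
proof
  assume "\<forall>\<^sub>F r in at_right 0. p' r = 0"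
  then have "\<forall>\<^sub>F r in at_right 0. r * \<bar>p' r\<bar> \<le> 0 * p r" by eventually_elim simp
  then show False using log_derivative_unbounded by blast
qed

lemma p'_no_linear_lower_bound:
  assumes "c > 0"
  shows "\<not> (\<forall>\<^sub>F r in at_right 0. c * r \<le> \<bar>p' r\<bar>)"
proof
  assume low: "\<forall>\<^sub>F r in at_right 0. c * r \<le> \<bar>p' r\<bar>"
  obtain C where C: "\<forall>\<^sub>F r in at_right 0. \<bar>p' r\<bar> \<le> C * r ^ 2" using flat' by blast
  have "((\<lambda>r. C * r) \<longlongrightarrow> C * 0) (at_right 0)" by (intro tendsto_intros)
  then have "\<forall>\<^sub>F r in at_right 0. C * r < c" by (rule order_tendstoD) (use assms in simp)
  then have "\<forall>\<^sub>F r in at_right (0::real). False"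
    using low C pos_r
  proof eventually_elim
    case (elim r)
    then have "c * r \<le> C * r\<^sup>2" by linarith
    also have "C * r\<^sup>2 = (C * r) * r" by (simp add: power2_eq_square)
    finally have "c * r \<le> (C * r) * r" .
    moreover have "(C * r) * r < c * r" using elim by (intro mult_strict_right_mono) auto
    ultimately show False by linarith
  qed
  then show False by (simp add: eventually_False)
qed

text \<open>
  Along any curve \<open>W\<close> with \<open>W \<sim> \<kappa> p\<close>, a holomorphic function of order \<open>n\<close> at \<open>0\<close> is
  \<open>c (\<kappa> p) ^ n + o(p ^ n)\<close>, where \<open>c\<close> is its first nonzero Taylor coefficient.
\<close>
lemma leading_term:
  assumes f: "f holomorphic_on ball 0 R" "R > 0"
  obtains "\<forall>w\<in>ball 0 R. f w = 0"
  | n c where "c \<noteq> 0" "n = 0 \<Longrightarrow> c = f 0"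
      "\<And>W \<kappa>. ((\<lambda>r. W r / of_real (p r)) \<longlongrightarrow> \<kappa>) (at_right 0) \<Longrightarrow>
        ((\<lambda>r. f (W r) / of_real (p r) ^ n) \<longlongrightarrow> c * \<kappa> ^ n) (at_right 0)"
proof -
  from holomorphic_zero_or_order [OF f]
  consider "\<forall>w\<in>ball 0 R. f w = 0"
    | n g where "isCont g 0" "g 0 \<noteq> 0" "\<forall>\<^sub>F w in nhds 0. f w = w ^ n * g w"
    by blast
  then show thesis
  proof cases
    case 1
    then show thesis by (rule that(1))
  next
    case (2 n g)
    have "f 0 = g 0" if "n = 0"
      using eventually_nhds_x_imp_x [OF 2(3)] that by simp
    moreover have "((\<lambda>r. f (W r) / of_real (p r) ^ n) \<longlongrightarrow> g 0 * \<kappa> ^ n) (at_right 0)"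
      if W: "((\<lambda>r. W r / of_real (p r)) \<longlongrightarrow> \<kappa>) (at_right 0)" for W \<kappa>
    proof -
      have "((\<lambda>r. W r / of_real (p r) * of_real (p r)) \<longlongrightarrow> \<kappa> * of_real 0) (at_right 0)"
        by (intro tendsto_intros W p_tendsto_0)
      then have W0: "(W \<longlongrightarrow> 0) (at_right 0)"
        by (rule Lim_transform_eventually [THEN tendsto_eq_rhs])
          (use pos in \<open>auto elim!: eventually_mono\<close>)
      have "((\<lambda>r. g (W r) * (W r / of_real (p r)) ^ n) \<longlongrightarrow> g 0 * \<kappa> ^ n) (at_right 0)"
        by (intro tendsto_intros W isCont_tendsto_compose [OF 2(1) W0])
      moreover have "\<forall>\<^sub>F r in at_right 0.
          g (W r) * (W r / of_real (p r)) ^ n = f (W r) / of_real (p r) ^ n"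
        using eventually_compose_filterlim [OF 2(3) W0]
        by eventually_elim (simp add: power_divide mult_ac)
      ultimately show ?thesis by (rule Lim_transform_eventually)
    qed
    ultimately show thesis using that(2) [of "g 0" n] 2(2) by auto
  qed
qed

lemma limit_lower_power:
  fixes F :: "real \<Rightarrow> complex"
  assumes F: "((\<lambda>r. F r / of_real (p r) ^ n) \<longlongrightarrow> L) (at_right 0)" and "m \<le> n"
  shows "\<exists>L'. ((\<lambda>r. F r / of_real (p r) ^ m) \<longlongrightarrow> L') (at_right 0)"
proof -
  have "((\<lambda>r. F r / of_real (p r) ^ n * of_real (p r) ^ (n - m)) \<longlongrightarrow> L * of_real 0 ^ (n - m)) (at_right 0)"
    by (intro tendsto_intros F p_tendsto_0)
  moreover have "\<forall>\<^sub>F r in at_right 0.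
      F r / of_real (p r) ^ n * of_real (p r) ^ (n - m) = F r / of_real (p r) ^ m"
    using pos
  proof eventually_elim
    case (elim r)
    have "of_real (p r) ^ n = (of_real (p r) ^ m * of_real (p r) ^ (n - m) :: complex)"
      using \<open>m \<le> n\<close> by (simp flip: power_add)
    then show ?case using elim by simp
  qed
  ultimately show ?thesis by (blast intro: Lim_transform_eventually)
qed

end

section \<open>Orders of vanishing along curves\<close>

text \<open>
  A family of curves \<open>W \<alpha>\<close> in the \<open>z\<^sub>1\<close>-plane, parametrized by the radius \<open>r = \<bar>z\<^sub>2\<bar>\<close>. The point
  \<open>(W \<alpha> r, z\<^sub>2)\<close> of the hypersurface has \<open>Im z\<^sub>1 = \<alpha> p r\<close>; there the gradient of \<open>\<rho>\<close> is given by
  \<open>2 \<rho>\<^bsub>z1\<^esub> = D \<alpha> r\<close> and \<open>2 z\<^sub>2 \<rho>\<^bsub>z2\<^esub> = S \<alpha> r\<close>. Apart from the exact value of \<open>S 0\<close>, only the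
  asymptotic behaviour for \<open>r \<rightarrow> 0\<close> with \<open>\<alpha>\<close> fixed is recorded; nothing is uniform in \<open>\<alpha>\<close>.
\<close>
locale tangency_curves = flat_profile +
  fixes W D :: "real \<Rightarrow> real \<Rightarrow> complex" and S :: "real \<Rightarrow> real \<Rightarrow> real"
  assumes W: "((\<lambda>r. W \<alpha> r / of_real (p r)) \<longlongrightarrow> \<i> * of_real \<alpha> - 1) (at_right 0)"
    and D: "(D \<alpha> \<longlongrightarrow> 1) (at_right 0)"
    and S: "((\<lambda>r. (S \<alpha> r - r * p' r) / p r) \<longlongrightarrow> 0) (at_right 0)"
    and S_0: "\<forall>\<^sub>F r in at_right 0. S 0 r = r * p' r"
begin

lemma W_tendsto_0: "(W \<alpha> \<longlongrightarrow> 0) (at_right 0)"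
proof -
  have "((\<lambda>r. W \<alpha> r / of_real (p r) * of_real (p r)) \<longlongrightarrow> (\<i> * of_real \<alpha> - 1) * of_real 0) (at_right 0)"
    by (intro tendsto_intros W p_tendsto_0)
  moreover have "\<forall>\<^sub>F r in at_right 0. W \<alpha> r / of_real (p r) * of_real (p r) = W \<alpha> r"
    using pos by eventually_elim simp
  ultimately show ?thesis by (simp add: tendsto_cong)
qed

lemma W_in_ball: "R > 0 \<Longrightarrow> \<forall>\<^sub>F r in at_right 0. W \<alpha> r \<in> ball 0 R"
  using tendstoD [OF W_tendsto_0] by (simp add: dist_norm)

lemma S_tendsto_0: "(S \<alpha> \<longlongrightarrow> 0) (at_right 0)"
proof -
  have "((\<lambda>r. (S \<alpha> r - r * p' r) / p r * p r + r * p' r) \<longlongrightarrow> 0 * 0 + 0) (at_right 0)"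
    by (intro tendsto_intros S p_tendsto_0 rp'_tendsto_0)
  moreover have "\<forall>\<^sub>F r in at_right 0. (S \<alpha> r - r * p' r) / p r * p r + r * p' r = S \<alpha> r"
    using pos by eventually_elim simp
  ultimately show ?thesis by (simp add: tendsto_cong)
qed

text \<open>
  This lemma and the next exclude, respectively, that the \<open>z\<^sub>1\<close>-component and that the \<open>z\<^sub>2\<close>-component
  dominates in the tangency condition. The first of these only uses that \<open>S\<close> tends to \<open>0\<close>.
\<close>
lemma transversal_term_not_dominant:
  fixes u v :: "real \<Rightarrow> complex"
  assumes a: "Re a \<noteq> 0"
    and u: "((\<lambda>r. u r / of_real (p r) ^ l) \<longlongrightarrow> a) (at_right 0)"
    and v: "((\<lambda>r. v r / of_real (p r) ^ l) \<longlongrightarrow> L) (at_right 0)"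
  shows "\<not> (\<forall>\<^sub>F r in at_right 0. Re (u r * D \<alpha> r + v r * of_real (S \<alpha> r)) = 0)"
proof
  assume eq: "\<forall>\<^sub>F r in at_right 0. Re (u r * D \<alpha> r + v r * of_real (S \<alpha> r)) = 0"
  have "((\<lambda>r. Re (u r / of_real (p r) ^ l * D \<alpha> r + v r / of_real (p r) ^ l * of_real (S \<alpha> r)))
      \<longlongrightarrow> Re (a * 1 + L * of_real 0)) (at_right 0)"
    by (intro tendsto_intros u v D S_tendsto_0)
  moreover have "\<forall>\<^sub>F r in at_right 0.
      Re (u r / of_real (p r) ^ l * D \<alpha> r + v r / of_real (p r) ^ l * of_real (S \<alpha> r)) = 0"
    using eq
  proof eventually_elim
    case (elim r)
    have "u r / of_real (p r) ^ l * D \<alpha> r + v r / of_real (p r) ^ l * of_real (S \<alpha> r) =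
        (u r * D \<alpha> r + v r * of_real (S \<alpha> r)) / of_real (p r ^ l)"
      by (simp add: add_divide_distrib)
    then show ?case using elim by (simp only: Re_divide_of_real div_0)
  qed
  ultimately have "((\<lambda>r. 0) \<longlongrightarrow> Re (a * 1 + L * of_real 0)) (at_right (0::real))"
    by (rule Lim_transform_eventually)
  from tendsto_unique [OF trivial_limit_at_right_real tendsto_const this] a show False by simp
qed

text \<open>
  Division by \<open>p ^ (n + 1)\<close> shows that \<open>S / p\<close> has a limit, and hence also \<open>r p' / p\<close>, contrary to flatness.
\<close>
lemma tangential_term_not_dominant:
  fixes u v :: "real \<Rightarrow> complex"
  assumes b: "Re b \<noteq> 0"
    and v: "((\<lambda>r. v r / of_real (p r) ^ n) \<longlongrightarrow> b) (at_right 0)"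
    and u: "((\<lambda>r. u r / of_real (p r) ^ Suc n) \<longlongrightarrow> L) (at_right 0)"
  shows "\<not> (\<forall>\<^sub>F r in at_right 0. Re (u r * D \<alpha> r + v r * of_real (S \<alpha> r)) = 0)"
proof
  assume eq: "\<forall>\<^sub>F r in at_right 0. Re (u r * D \<alpha> r + v r * of_real (S \<alpha> r)) = 0"
  define x where "x r = Re (v r / of_real (p r) ^ n)" for r
  define y where "y r = Re (u r / of_real (p r) ^ Suc n * D \<alpha> r)" for r
  have x: "(x \<longlongrightarrow> Re b) (at_right 0)" unfolding x_def by (intro tendsto_intros v)
  have y: "(y \<longlongrightarrow> Re (L * 1)) (at_right 0)" unfolding y_def by (intro tendsto_intros u D)
  define K where "K = - (Re (L * 1) / Re b) - 0"
  have "((\<lambda>r. - (y r / x r) - (S \<alpha> r - r * p' r) / p r) \<longlongrightarrow> K) (at_right 0)"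
    unfolding K_def by (intro tendsto_intros x y S b)
  then have "((\<lambda>r. \<bar>- (y r / x r) - (S \<alpha> r - r * p' r) / p r\<bar>) \<longlongrightarrow> \<bar>K\<bar>) (at_right 0)"
    by (rule tendsto_rabs)
  then have "\<forall>\<^sub>F r in at_right 0. \<bar>- (y r / x r) - (S \<alpha> r - r * p' r) / p r\<bar> < \<bar>K\<bar> + 1"
    by (rule order_tendstoD) simp
  moreover have "\<forall>\<^sub>F r in at_right 0. x r \<noteq> 0"
    using tendsto_imp_eventually_ne [OF x b] .
  ultimately have "\<forall>\<^sub>F r in at_right 0. r * \<bar>p' r\<bar> \<le> (\<bar>K\<bar> + 1) * p r"
    using eq pos pos_r
  proof eventually_elim
    case (elim r)
    have "v r / of_real (p r) ^ n = v r / of_real (p r ^ n)" by simp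
    then have xv: "x r = Re (v r) / p r ^ n" unfolding x_def by (simp only: Re_divide_of_real)
    define q where "q = Re (u r * D \<alpha> r)"
    have "u r / of_real (p r) ^ Suc n * D \<alpha> r = u r * D \<alpha> r / of_real (p r ^ Suc n)" by simp
    then have yu: "y r = q / p r ^ Suc n"
      unfolding y_def q_def by (simp only: Re_divide_of_real)
    have "q + Re (v r) * S \<alpha> r = 0" using elim by (simp add: q_def)
    moreover have "y r * p r + x r * S \<alpha> r = (q + Re (v r) * S \<alpha> r) / p r ^ n"
      using elim(4) by (simp add: xv yu add_divide_distrib)
    ultimately have "y r * p r + x r * S \<alpha> r = 0" by simp
    then have "S \<alpha> r / p r = - (y r / x r)" using elim by (simp add: field_simps)
    then have "- (y r / x r) - (S \<alpha> r - r * p' r) / p r = r * p' r / p r"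
      by (simp add: diff_divide_distrib)
    then have "\<bar>r * p' r / p r\<bar> \<le> \<bar>K\<bar> + 1" using elim by simp
    then show ?case using elim by (simp add: abs_mult divide_le_eq)
  qed
  then show False using log_derivative_unbounded by blast
qed

text \<open>
  The rotationally invariant part of the problem. One compares the order \<open>l\<close> of \<open>u\<close> with the order \<open>n\<close> of
  \<open>v\<close>: the first term is dominant if \<open>l \<le> n\<close>, the second one otherwise. In both cases \<open>\<alpha>\<close> can be chosen so
  that the leading coefficient has nonzero real part.
\<close>
lemma Re_tangency_rigidity:
  assumes u: "u holomorphic_on ball 0 R" and v: "v holomorphic_on ball 0 R" and R: "R > 0"
    and u0: "u 0 = 0"
    and eq: "\<And>\<alpha>. \<forall>\<^sub>F r in at_right 0. Re (u (W \<alpha> r) * D \<alpha> r + v (W \<alpha> r) * of_real (S \<alpha> r)) = 0"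
  shows "\<exists>\<beta>::real. \<forall>w\<in>ball 0 R. u w = 0 \<and> v w = \<i> * of_real \<beta>"
proof -
  \<comment> \<open>As \<open>S\<close> is real, an imaginary constant in \<open>v\<close> does not contribute. Without it, the leading
    coefficient of \<open>v\<close> is real if \<open>n = 0\<close>.\<close>
  define v0 where "v0 w = v w - \<i> * of_real (Im (v 0))" for w
  have v0: "v0 holomorphic_on ball 0 R" unfolding v0_def by (intro holomorphic_intros v)
  have eq0: "\<forall>\<^sub>F r in at_right 0. Re (u (W \<alpha> r) * D \<alpha> r + v0 (W \<alpha> r) * of_real (S \<alpha> r)) = 0" for \<alpha>
    using eq [of \<alpha>] by eventually_elim (simp add: v0_def algebra_simps)
  have zero: "((\<lambda>r. f (W \<alpha> r) / of_real (p r) ^ m) \<longlongrightarrow> 0) (at_right 0)"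
    if f: "\<forall>w\<in>ball 0 R. f w = (0::complex)" for f \<alpha> m
  proof -
    from W_in_ball [OF R] have "\<forall>\<^sub>F r in at_right 0. 0 = f (W \<alpha> r) / of_real (p r) ^ m"
      by eventually_elim (use f in auto)
    then show ?thesis by (rule Lim_transform_eventually [OF tendsto_const])
  qed
  have "(\<forall>w\<in>ball 0 R. u w = 0) \<and> (\<forall>w\<in>ball 0 R. v0 w = 0)"
  proof (cases rule: leading_term [OF u R])
    case u: 1
    show ?thesis
    proof (cases rule: leading_term [OF v0 R])
      case 1
      then show ?thesis using u by blast
    next
      case (2 n b)
      have "n \<noteq> 0 \<or> Re b \<noteq> 0" using 2(1,2) by (auto simp: v0_def complex_eq_iff)
      then obtain \<alpha> :: real where "Re (b * (\<i> * of_real \<alpha> - 1) ^ n) \<noteq> 0"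
        using Re_power_nonzero [OF 2(1)] by blast
      from tangential_term_not_dominant [OF this 2(3) [OF W] zero [OF u], of \<alpha>] eq0 [of \<alpha>]
      show ?thesis by contradiction
    qed
  next
    case u: (2 l a)
    have l: "l \<noteq> 0" using u(1,2) u0 by auto
    obtain \<alpha>1 :: real where \<alpha>1: "Re (a * (\<i> * of_real \<alpha>1 - 1) ^ l) \<noteq> 0"
      using Re_power_nonzero [OF u(1)] l by blast
    note tr = transversal_term_not_dominant [OF \<alpha>1 u(3) [OF W], where \<alpha> = \<alpha>1]
    show ?thesis
    proof (cases rule: leading_term [OF v0 R])
      case 1
      from tr [OF zero [OF 1]] eq0 [of \<alpha>1] show ?thesis by contradiction
    next
      case (2 n b)
      have nb: "n \<noteq> 0 \<or> Re b \<noteq> 0" using 2(1,2) by (auto simp: v0_def complex_eq_iff)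
      then obtain \<alpha> :: real where \<alpha>: "Re (b * (\<i> * of_real \<alpha> - 1) ^ n) \<noteq> 0"
        using Re_power_nonzero [OF 2(1)] by blast
      show ?thesis
      proof (cases "l \<le> n")
        case True
        from limit_lower_power [OF 2(3) [OF W] this] obtain L where
          "((\<lambda>r. v0 (W \<alpha>1 r) / of_real (p r) ^ l) \<longlongrightarrow> L) (at_right 0)" by blast
        from tr [OF this] eq0 [of \<alpha>1] show ?thesis by contradiction
      next
        case False
        then have "Suc n \<le> l" by simp
        from limit_lower_power [OF u(3) [OF W] this] obtain L where
          "((\<lambda>r. u (W \<alpha> r) / of_real (p r) ^ Suc n) \<longlongrightarrow> L) (at_right 0)" by blast
        from tangential_term_not_dominant [OF \<alpha> 2(3) [OF W] this, of \<alpha>] eq0 [of \<alpha>]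
        show ?thesis by contradiction
      qed
    qed
  qed
  then show ?thesis by (intro exI [of _ "Im (v 0)"]) (auto simp: v0_def)
qed

text \<open>
  The part of the problem that couples the terms of rotational weights \<open>1\<close> and \<open>-1\<close>. The curve
  \<open>\<alpha> = 0\<close> suffices. Let \<open>G = r\<^sup>2 v + c cnj g\<close>, so that \<open>r\<^sup>2 u D = - r p' G\<close>. If \<open>g\<close> is not zero, then \<open>G\<close> has the
  size of \<open>E p ^ m\<close> with \<open>E = 1\<close> or \<open>E = r\<^sup>2\<close>, whereas \<open>u D\<close> has the size of some \<open>p ^ l\<close>, unless
  \<open>u = 0\<close> and \<open>p' = 0\<close> near \<open>0\<close>. If \<open>l > m\<close>, it follows
  that \<open>r \<bar>p'\<bar> = O(p)\<close>; if \<open>l \<le> m\<close>, then \<open>\<bar>p'\<bar>\<close> is at least a multiple of \<open>r\<close>. Both are impossible.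
\<close>
lemma rotating_term_vanishes:
  fixes c :: complex
  assumes u: "u holomorphic_on ball 0 R" and v: "v holomorphic_on ball 0 R"
    and g: "g holomorphic_on ball 0 R" and R: "R > 0" and c: "c \<noteq> 0"
    and eq: "\<forall>\<^sub>F r in at_right 0. of_real (r\<^sup>2) * u (W 0 r) * D 0 r +
      of_real (S 0 r) * (of_real (r\<^sup>2) * v (W 0 r) + c * cnj (g (W 0 r))) = 0"
  shows "\<forall>w\<in>ball 0 R. g w = 0"
proof (cases rule: leading_term [OF g R])
  case g: (2 k \<gamma>)
  define G where "G r = of_real (r\<^sup>2) * v (W 0 r) + c * cnj (g (W 0 r))" for r
  note ball = W_in_ball [OF R, of 0]
  have W0: "((\<lambda>r. W 0 r / of_real (p r)) \<longlongrightarrow> - 1) (at_right 0)"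
    using W [of 0] by simp
  note glim = g(3) [OF W0]
  have r2: "((\<lambda>r. of_real (r\<^sup>2)) \<longlongrightarrow> (0::complex)) (at_right 0)"
    by (auto intro!: tendsto_eq_intros)
  have case1: "\<exists>L. L \<noteq> 0 \<and> ((\<lambda>r. G r / (of_real 1 * of_real (p r) ^ k)) \<longlongrightarrow> L) (at_right 0)"
    if v: "((\<lambda>r. v (W 0 r) / of_real (p r) ^ k) \<longlongrightarrow> L') (at_right 0)" for L'
  proof -
    have "((\<lambda>r. of_real (r\<^sup>2) * (v (W 0 r) / of_real (p r) ^ k) +
         c * cnj (g (W 0 r) / of_real (p r) ^ k)) \<longlongrightarrow> 0 * L' + c * cnj (\<gamma> * (- 1) ^ k)) (at_right 0)"
      by (intro tendsto_intros v r2 glim)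
    then have "((\<lambda>r. G r / (of_real 1 * of_real (p r) ^ k)) \<longlongrightarrow> c * cnj (\<gamma> * (- 1) ^ k)) (at_right 0)"
      by (simp add: G_def add_divide_distrib)
    moreover have "c * cnj (\<gamma> * (- 1) ^ k) \<noteq> 0" using c g(1) by simp
    ultimately show ?thesis by blast
  qed
  have "\<exists>E m L. (\<forall>\<^sub>F r in at_right 0. r\<^sup>2 \<le> E r \<and> E r \<le> 1) \<and> L \<noteq> 0 \<and>
      ((\<lambda>r. G r / (of_real (E r) * of_real (p r) ^ m)) \<longlongrightarrow> L) (at_right 0)"
  proof -
    have small: "\<forall>\<^sub>F r in at_right (0::real). r\<^sup>2 \<le> 1"
      by (auto simp: eventually_at_right_field power_le_one intro!: exI [of _ 1])
    have one: ?thesis if "((\<lambda>r. v (W 0 r) / of_real (p r) ^ k) \<longlongrightarrow> L') (at_right 0)" for L'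
      using case1 [OF that] small
      by (intro exI [of _ "\<lambda>_. 1"] exI [of _ k]) auto
    show ?thesis
    proof (cases rule: leading_term [OF v R])
      case 1
      have "\<forall>\<^sub>F r in at_right 0. 0 = v (W 0 r) / of_real (p r) ^ k"
        using ball by eventually_elim (use 1 in auto)
      from one [OF Lim_transform_eventually [OF tendsto_const this]] show ?thesis .
    next
      case (2 n b)
      note vlim = 2(3) [OF W0]
      show ?thesis
      proof (cases "k \<le> n")
        case True
        from limit_lower_power [OF vlim True] one show ?thesis by blast
      next
        \<comment> \<open>The contribution of \<open>g\<close> to \<open>G / (r\<^sup>2 p ^ n)\<close> contains the factor \<open>p / r\<^sup>2 \<rightarrow> 0\<close>.\<close>
        case False
        then obtain j where j: "k = n + Suc j" using less_imp_Suc_add by (metis add_Suc_right not_le)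
        have "((\<lambda>r. v (W 0 r) / of_real (p r) ^ n + c * cnj (g (W 0 r) / of_real (p r) ^ k) *
             (of_real (p r / r ^ 2) * of_real (p r) ^ j))
          \<longlongrightarrow> b * (- 1) ^ n + c * cnj (\<gamma> * (- 1) ^ k) * (of_real 0 * of_real 0 ^ j)) (at_right 0)"
          by (intro tendsto_intros vlim glim p_over_power p_tendsto_0)
        moreover have "\<forall>\<^sub>F r in at_right 0.
            v (W 0 r) / of_real (p r) ^ n + c * cnj (g (W 0 r) / of_real (p r) ^ k) *
             (of_real (p r / r ^ 2) * of_real (p r) ^ j) =
            G r / (of_real (r\<^sup>2) * of_real (p r) ^ n)"
          using pos pos_r
        proof eventually_elim
          case (elim r)
          then show ?case by (simp add: G_def j power_add field_simps)
        qed
        ultimately have "((\<lambda>r. G r / (of_real (r\<^sup>2) * of_real (p r) ^ n)) \<longlongrightarrow> b * (- 1) ^ n) (at_right 0)"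
          by (simp add: tendsto_cong)
        moreover have "b * (- 1) ^ n \<noteq> 0" using 2(1) by simp
        moreover have "\<forall>\<^sub>F r in at_right (0::real). r\<^sup>2 \<le> r\<^sup>2 \<and> r\<^sup>2 \<le> 1"
          using small by simp
        ultimately show ?thesis
          by (intro exI [of _ "\<lambda>r. r\<^sup>2"] exI [of _ n] exI [of _ "b * (- 1) ^ n"] conjI)
      qed
    qed
  qed
  then obtain E m L where E: "\<forall>\<^sub>F r in at_right 0. r\<^sup>2 \<le> E r \<and> E r \<le> 1" and L: "L \<noteq> 0"
    and GL: "((\<lambda>r. G r / (of_real (E r) * of_real (p r) ^ m)) \<longlongrightarrow> L) (at_right 0)" by blast
  have eqG: "\<forall>\<^sub>F r in at_right 0. of_real (r\<^sup>2) * u (W 0 r) * D 0 r + of_real (r * p' r) * G r = 0"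
    using eq S_0 by eventually_elim (simp add: G_def)
  define y where "y r = norm (G r / (of_real (E r) * of_real (p r) ^ m))" for r
  have y: "(y \<longlongrightarrow> norm L) (at_right 0)" unfolding y_def by (intro tendsto_intros GL)
  have y1: "\<forall>\<^sub>F r in at_right 0. norm L / 2 < y r" and y2: "\<forall>\<^sub>F r in at_right 0. y r < 2 * norm L"
    using L by (intro order_tendstoD [OF y]; simp)+
  have False
  proof (cases rule: leading_term [OF u R])
    case 1
    have "\<forall>\<^sub>F r in at_right 0. p' r = 0"
      using ball eqG y1 pos_r
    proof eventually_elim
      case (elim r)
      have "G r \<noteq> 0" using elim(3) L by (auto simp: y_def)
      then show ?case using elim 1 by auto
    qed
    then show False using p'_not_eventually_0 by blast
  next
    case (2 l a)
    define x where "x r = norm (u (W 0 r) / of_real (p r) ^ l * D 0 r)" for r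
    have x: "(x \<longlongrightarrow> norm (a * (- 1) ^ l * 1)) (at_right 0)"
      unfolding x_def by (intro tendsto_intros 2(3) [OF W0] D)
    then have x: "(x \<longlongrightarrow> norm a) (at_right 0)" by (simp add: norm_mult norm_power)
    have x1: "\<forall>\<^sub>F r in at_right 0. norm a / 2 < x r" and x2: "\<forall>\<^sub>F r in at_right 0. x r < 2 * norm a"
      using 2(1) by (intro order_tendstoD [OF x]; simp)+
    have p1: "\<forall>\<^sub>F r in at_right 0. p r < 1"
      by (rule order_tendstoD [OF p_tendsto_0]) simp
    have main: "\<forall>\<^sub>F r in at_right 0. r\<^sup>2 * x r * p r ^ l = r * \<bar>p' r\<bar> * (y r * E r * p r ^ m)"
      using eqG pos pos_r E
    proof eventually_elim
      case (elim r)
      have E0: "E r > 0" using elim(3,4) by (meson less_le_trans zero_less_power)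
      have X: "norm (u (W 0 r) * D 0 r) = x r * p r ^ l"
        using elim by (simp add: x_def norm_mult norm_divide norm_power)
      have Y: "norm (G r) = y r * E r * p r ^ m"
        using elim E0 by (simp add: y_def norm_mult norm_divide norm_power)
      have "of_real (r\<^sup>2) * (u (W 0 r) * D 0 r) = - (of_real (r * p' r) * G r)"
        using elim(1) by (simp add: add_eq_0_iff mult.assoc)
      then have "norm (of_real (r\<^sup>2) * (u (W 0 r) * D 0 r)) = norm (of_real (r * p' r) * G r)"
        by (simp only: norm_minus_cancel)
      then have "r\<^sup>2 * norm (u (W 0 r) * D 0 r) = r * \<bar>p' r\<bar> * norm (G r)"
        using elim(3) unfolding norm_mult norm_of_real by (simp add: abs_mult)
      then show ?case unfolding X Y by (simp add: mult_ac)
    qed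
    show False
    proof (cases "l \<le> m")
      case True
      have "\<forall>\<^sub>F r in at_right 0. (norm a / (4 * norm L)) * r \<le> \<bar>p' r\<bar>"
        using main x1 y2 y1 E pos pos_r p1
      proof eventually_elim
        case (elim r)
        have "E r \<ge> 0" using elim(5) order_trans [OF zero_le_power2] by blast
        have "y r > 0" using elim(4) norm_ge_zero [of L] by linarith
        have pm: "p r ^ m = p r ^ l * p r ^ (m - l)" using True by (simp flip: power_add)
        have "r * (r * x r) * p r ^ l = r\<^sup>2 * x r * p r ^ l" by (simp add: power2_eq_square)
        also have "\<dots> = r * (\<bar>p' r\<bar> * (y r * (E r * p r ^ (m - l)))) * p r ^ l"
          unfolding elim(1) pm by (simp only: mult_ac)
        finally have "r * x r = \<bar>p' r\<bar> * (y r * (E r * p r ^ (m - l)))" using elim by simp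
        also have "\<dots> \<le> \<bar>p' r\<bar> * (2 * norm L * 1)"
        proof (intro mult_left_mono mult_mono)
          have "E r * p r ^ (m - l) \<le> 1 * 1"
            using elim \<open>E r \<ge> 0\<close> by (intro mult_mono power_le_one) auto
          then show "E r * p r ^ (m - l) \<le> 1" by simp
        qed (use elim \<open>E r \<ge> 0\<close> \<open>y r > 0\<close> in auto)
        finally have "r * x r \<le> \<bar>p' r\<bar> * (2 * norm L)" by simp
        moreover have "r * (norm a / 2) \<le> r * x r" using elim by (intro mult_left_mono) auto
        ultimately show ?case using L by (simp add: field_simps)
      qed
      moreover have "norm a / (4 * norm L) > 0" using L 2(1) by simp
      ultimately show False using p'_no_linear_lower_bound by blast
    next
      case False
      then obtain j where j: "l = m + Suc j" using less_imp_Suc_add by (metis add_Suc_right not_le)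
      have "\<forall>\<^sub>F r in at_right 0. r * \<bar>p' r\<bar> \<le> (4 * norm a / norm L) * p r"
        using main x2 y1 E pos pos_r p1
      proof eventually_elim
        case (elim r)
        have "y r > 0" using elim(3) norm_ge_zero [of L] by linarith
        have "x r \<ge> 0" by (simp add: x_def)
        have "(r\<^sup>2 * x r * (p r * p r ^ j)) * p r ^ m = r\<^sup>2 * x r * p r ^ l"
          by (simp add: j power_add)
        also have "\<dots> = (r * \<bar>p' r\<bar> * (y r * E r)) * p r ^ m"
          unfolding elim(1) by (simp only: mult_ac)
        finally have "(r\<^sup>2 * x r * (p r * p r ^ j)) * p r ^ m = (r * \<bar>p' r\<bar> * (y r * E r)) * p r ^ m" .
        then have e: "r\<^sup>2 * x r * (p r * p r ^ j) = r * \<bar>p' r\<bar> * (y r * E r)" using elim by simp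
        have "r * \<bar>p' r\<bar> * (norm L / 2 * r\<^sup>2) \<le> r * \<bar>p' r\<bar> * (y r * E r)"
          using elim \<open>y r > 0\<close> by (intro mult_left_mono mult_mono) auto
        also have "\<dots> = r\<^sup>2 * x r * (p r * p r ^ j)" using e by simp
        also have "\<dots> \<le> r\<^sup>2 * (2 * norm a) * (p r * 1)"
          using elim \<open>x r \<ge> 0\<close> by (intro mult_mono power_le_one) auto
        finally have "(r * \<bar>p' r\<bar> * (norm L / 2)) * r\<^sup>2 \<le> (2 * norm a * p r) * r\<^sup>2"
          by (simp add: mult_ac)
        then have "r * \<bar>p' r\<bar> * (norm L / 2) \<le> 2 * norm a * p r"
          using elim by (simp add: mult_le_cancel_right)
        then show ?case using L by (simp add: field_simps)
      qed
      then show False using log_derivative_unbounded by blast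
    qed
  qed
  then show ?thesis ..
qed

section \<open>Rigidity in two variables\<close>

text \<open>
  Here \<open>h1\<close> and \<open>h2\<close> are the components of a vector field, and separate holomorphy is all that is used.
\<close>
theorem tangency_rigidity:
  fixes h1 h2 :: "complex \<times> complex \<Rightarrow> complex"
  assumes R: "R > 0"
    and h1_1: "\<And>z. z \<in> ball 0 R \<Longrightarrow> (\<lambda>w. h1 (w, z)) holomorphic_on ball 0 R"
    and h1_2: "\<And>w. w \<in> ball 0 R \<Longrightarrow> (\<lambda>z. h1 (w, z)) holomorphic_on ball 0 R"
    and h2_1: "\<And>z. z \<in> ball 0 R \<Longrightarrow> (\<lambda>w. h2 (w, z)) holomorphic_on ball 0 R"
    and h2_2: "\<And>w. w \<in> ball 0 R \<Longrightarrow> (\<lambda>z. h2 (w, z)) holomorphic_on ball 0 R"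
    and h1_0: "h1 (0, 0) = 0"
    and eq: "\<And>\<alpha>. \<forall>\<^sub>F r in at_right 0. \<forall>z. norm z = r \<longrightarrow>
      Re (h1 (W \<alpha> r, z) * D \<alpha> r + h2 (W \<alpha> r, z) * of_real (S \<alpha> r) / z) = 0"
  shows "\<exists>\<beta>::real. \<forall>w\<in>ball 0 R. \<forall>z\<in>ball 0 R. h1 (w, z) = 0 \<and> h2 (w, z) = \<i> * of_real \<beta> * z"
proof -
  \<comment> \<open>The tangency condition says that \<open>\<phi> z / z\<close> is imaginary for \<open>\<bar>z\<bar> = r\<close>. Thus \<open>\<phi>\<close> is a quadratic
    polynomial on the whole disc of radius \<open>R\<close>, although \<open>r\<close> is small.\<close>
  define \<phi> where "\<phi> \<alpha> r z = z * h1 (W \<alpha> r, z) * D \<alpha> r + h2 (W \<alpha> r, z) * of_real (S \<alpha> r)" for \<alpha> r z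
  have less_R: "\<forall>\<^sub>F r in at_right 0. r < R"
    using R by (auto simp: eventually_at_right_field)
  have quad: "\<forall>\<^sub>F r in at_right 0. \<exists>k::real. \<forall>z\<in>ball 0 R.
      \<phi> \<alpha> r z = \<phi> \<alpha> r 0 + \<i> * of_real k * z - cnj (\<phi> \<alpha> r 0) * z\<^sup>2 / of_real (r\<^sup>2)" for \<alpha>
    using eq [of \<alpha>] W_in_ball [OF R, of \<alpha>] pos_r less_R
  proof eventually_elim
    case (elim r)
    show ?case
    proof (rule quadratic_of_Re_zero_on_circle)
      show "\<phi> \<alpha> r holomorphic_on ball 0 R"
        unfolding \<phi>_def by (intro holomorphic_intros h1_2 h2_2 elim)
      fix z :: complex assume z: "norm z = r"
      then have "z \<noteq> 0" using elim by auto
      then have "\<phi> \<alpha> r z / z = h1 (W \<alpha> r, z) * D \<alpha> r + h2 (W \<alpha> r, z) * of_real (S \<alpha> r) / z"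
        by (simp add: \<phi>_def add_divide_distrib)
      then show "Re (\<phi> \<alpha> r z / z) = 0" using elim(1) z by auto
    qed (use elim in auto)
  qed
  have g: "\<forall>w\<in>ball 0 R. h2 (w, 0) = 0"
  proof -
    \<comment> \<open>The second difference \<open>\<phi> a + \<phi> (- a) - 2 \<phi> 0\<close> isolates the quadratic term of \<open>\<phi>\<close>. It is formed from the
      values of \<open>h1\<close> and \<open>h2\<close> at fixed \<open>z\<^sub>2\<close>, which are holomorphic in \<open>z\<^sub>1\<close>.\<close>
    define a :: complex where "a = of_real (R / 2)"
    have a: "a \<in> ball 0 R" "- a \<in> ball 0 R" "(0::complex) \<in> ball 0 R" "a \<noteq> 0"
      using R by (auto simp: a_def)
    show ?thesis
    proof (rule rotating_term_vanishes
        [of "\<lambda>w. a * (h1 (w, a) - h1 (w, - a))" R "\<lambda>w. h2 (w, a) + h2 (w, - a) - 2 * h2 (w, 0)"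
          "\<lambda>w. h2 (w, 0)" "2 * a\<^sup>2"])
      show "\<forall>\<^sub>F r in at_right 0.
          of_real (r\<^sup>2) * (a * (h1 (W 0 r, a) - h1 (W 0 r, - a))) * D 0 r +
          of_real (S 0 r) * (of_real (r\<^sup>2) * (h2 (W 0 r, a) + h2 (W 0 r, - a) - 2 * h2 (W 0 r, 0)) +
            2 * a\<^sup>2 * cnj (h2 (W 0 r, 0))) = 0"
        using quad [of 0] pos_r
      proof eventually_elim
        case (elim r)
        define q where "q = (of_real (r\<^sup>2) :: complex)"
        have q: "q \<noteq> 0" using elim by (simp add: q_def)
        from elim(1) obtain k :: real where k: "\<And>z. z \<in> ball 0 R \<Longrightarrow>
            \<phi> 0 r z = \<phi> 0 r 0 + \<i> * of_real k * z - cnj (\<phi> 0 r 0) * z\<^sup>2 / q"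
          unfolding q_def by blast
        have c: "\<phi> 0 r 0 = h2 (W 0 r, 0) * of_real (S 0 r)" by (simp add: \<phi>_def)
        have "\<phi> 0 r a + \<phi> 0 r (- a) - 2 * \<phi> 0 r 0 = - 2 * (cnj (\<phi> 0 r 0) * a\<^sup>2 / q)"
          using k [OF a(1)] k [OF a(2)] by simp
        then have "q * (\<phi> 0 r a + \<phi> 0 r (- a) - 2 * \<phi> 0 r 0) + 2 * a\<^sup>2 * cnj (\<phi> 0 r 0) = 0"
          using q by simp
        then show ?case
          unfolding q_def [symmetric] by (simp add: c) (simp add: \<phi>_def algebra_simps)
      qed
    qed (use a R in \<open>auto intro!: holomorphic_intros h1_1 h2_1\<close>)
  qed
  have lin: "\<forall>\<^sub>F r in at_right 0. \<exists>k::real. \<forall>z\<in>ball 0 R - {0}.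
      h1 (W \<alpha> r, z) * D \<alpha> r + h2 (W \<alpha> r, z) / z * of_real (S \<alpha> r) = \<i> * of_real k" for \<alpha>
    using quad [of \<alpha>] W_in_ball [OF R, of \<alpha>]
  proof eventually_elim
    case (elim r)
    have "\<phi> \<alpha> r 0 = 0" using g elim(2) by (simp add: \<phi>_def)
    with elim(1) have "\<exists>k::real. \<forall>z\<in>ball 0 R. \<phi> \<alpha> r z = \<i> * of_real k * z" by simp
    then obtain k :: real where k: "\<And>z. z \<in> ball 0 R \<Longrightarrow> \<phi> \<alpha> r z = \<i> * of_real k * z"
      by blast
    show ?case
    proof (intro exI ballI)
      fix z :: complex assume z: "z \<in> ball 0 R - {0}"
      then have "\<phi> \<alpha> r z / z = \<i> * of_real k" using k [of z] by simp
      then show "h1 (W \<alpha> r, z) * D \<alpha> r + h2 (W \<alpha> r, z) / z * of_real (S \<alpha> r) = \<i> * of_real k"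
        using z by (simp add: \<phi>_def add_divide_distrib)
    qed
  qed
  have cont: "((\<lambda>r. f (W \<alpha> r)) \<longlongrightarrow> f 0) (at_right 0)" if "f holomorphic_on ball 0 R" for f \<alpha>
  proof (rule isCont_tendsto_compose [OF _ W_tendsto_0])
    show "isCont f 0"
      using continuous_on_interior [OF holomorphic_on_imp_continuous_on [OF that], of 0] R by auto
  qed
  have lim0: "((\<lambda>z. f z) \<longlongrightarrow> f 0) (at 0)" if "f holomorphic_on ball 0 R" for f :: "complex \<Rightarrow> complex"
    using continuous_on_interior [OF holomorphic_on_imp_continuous_on [OF that], of 0] R
    by (simp add: isCont_def)
  have near0: "\<forall>\<^sub>F z in at 0. z \<in> ball 0 R - {0::complex}"
    using R by (auto simp: eventually_at dist_norm)
  have R0: "(0::complex) \<in> ball 0 R" using R by simp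
  have lim: "((\<lambda>r. h1 (W 0 r, z) * D 0 r + h2 (W 0 r, z) / z * of_real (S 0 r)) \<longlongrightarrow> h1 (0, z)) (at_right 0)"
    if z: "z \<in> ball 0 R - {0}" for z
  proof -
    have "((\<lambda>r. h1 (W 0 r, z) * D 0 r + h2 (W 0 r, z) / z * of_real (S 0 r))
        \<longlongrightarrow> h1 (0, z) * 1 + h2 (0, z) / z * of_real 0) (at_right 0)"
      by (intro tendsto_intros D S_tendsto_0 cont [of "\<lambda>w. h1 (w, z)"] cont [of "\<lambda>w. h2 (w, z)"]
          h1_1 h2_1) (use z in auto)
    then show ?thesis by simp
  qed
  \<comment> \<open>as \<open>\<phi> z / z\<close> does not depend on \<open>z\<close>, neither does its limit \<open>h1 (0, z)\<close>\<close>
  have h1_axis: "h1 (0, z) = 0" if z: "z \<in> ball 0 R - {0}" for z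
  proof -
    have same: "h1 (0, z') = h1 (0, z)" if z': "z' \<in> ball 0 R - {0}" for z'
    proof -
      have "\<forall>\<^sub>F r in at_right 0. h1 (W 0 r, z') * D 0 r + h2 (W 0 r, z') / z' * of_real (S 0 r) =
          h1 (W 0 r, z) * D 0 r + h2 (W 0 r, z) / z * of_real (S 0 r)"
        using lin [of 0] by eventually_elim (use z z' in metis)
      from Lim_transform_eventually [OF lim [OF z'] this]
      show ?thesis using lim [OF z] tendsto_unique trivial_limit_at_right_real by blast
    qed
    have "\<forall>\<^sub>F z' in at 0. h1 (0, z') = h1 (0, z)" using near0 by eventually_elim (rule same)
    from Lim_transform_eventually [OF lim0 [OF h1_2 [OF R0]] this]
    show ?thesis using h1_0 LIM_const_eq by metis
  qed
  have "\<exists>\<beta>::real. \<forall>w\<in>ball 0 R. h1 (w, z) = 0 \<and> h2 (w, z) / z = \<i> * of_real \<beta>"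
    if z: "z \<in> ball 0 R - {0}" for z
  proof (rule Re_tangency_rigidity)
    show "\<forall>\<^sub>F r in at_right 0. Re (h1 (W \<alpha> r, z) * D \<alpha> r + h2 (W \<alpha> r, z) / z * of_real (S \<alpha> r)) = 0" for \<alpha>
      using lin [of \<alpha>]
    proof eventually_elim
      case (elim r)
      then obtain k :: real where
        "h1 (W \<alpha> r, z) * D \<alpha> r + h2 (W \<alpha> r, z) / z * of_real (S \<alpha> r) = \<i> * of_real k"
        using z by blast
      then show ?case by (simp only: Re_i_times Im_complex_of_real minus_zero)
    qed
  qed (use z R h1_axis [OF z] in \<open>auto intro!: holomorphic_intros h1_1 h2_1\<close>)
  then obtain \<beta> :: "complex \<Rightarrow> real" where \<beta>: "\<And>z w. z \<in> ball 0 R - {0} \<Longrightarrow> w \<in> ball 0 R \<Longrightarrow>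
      h1 (w, z) = 0 \<and> h2 (w, z) / z = \<i> * of_real (\<beta> z)"
    by metis
  \<comment> \<open>Now \<open>\<phi> z / z = \<i> (\<beta> z) S\<close>, and \<open>S\<close> is nonzero for some \<open>r\<close>.\<close>
  obtain b where b: "\<And>z. z \<in> ball 0 R - {0} \<Longrightarrow> \<beta> z = b"
  proof -
    have "\<exists>\<^sub>F r in at_right 0. p' r \<noteq> 0"
      using p'_not_eventually_0 by (simp add: frequently_def)
    moreover have "\<forall>\<^sub>F r in at_right 0. r > 0 \<and> W 0 r \<in> ball 0 R \<and> S 0 r = r * p' r \<and>
        (\<exists>k::real. \<forall>z\<in>ball 0 R - {0}.
          h1 (W 0 r, z) * D 0 r + h2 (W 0 r, z) / z * of_real (S 0 r) = \<i> * of_real k)"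
      using pos_r W_in_ball [OF R, of 0] S_0 lin [of 0] by eventually_elim blast
    ultimately have "\<exists>\<^sub>F r in at_right 0. p' r \<noteq> 0 \<and> r > 0 \<and> W 0 r \<in> ball 0 R \<and> S 0 r = r * p' r \<and>
        (\<exists>k::real. \<forall>z\<in>ball 0 R - {0}.
          h1 (W 0 r, z) * D 0 r + h2 (W 0 r, z) / z * of_real (S 0 r) = \<i> * of_real k)"
      by (rule frequently_eventually_frequently)
    then obtain r k where r: "p' r \<noteq> 0" "r > 0" "W 0 r \<in> ball 0 R" "S 0 r = r * p' r"
      and k: "\<And>z. z \<in> ball 0 R - {0} \<Longrightarrow>
          h1 (W 0 r, z) * D 0 r + h2 (W 0 r, z) / z * of_real (S 0 r) = \<i> * of_real k"
      using frequently_ex by blast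
    show thesis
    proof (rule that [of "k / S 0 r"])
      fix z :: complex assume z: "z \<in> ball 0 R - {0}"
      have "\<i> * of_real (\<beta> z) * of_real (S 0 r) = \<i> * of_real k"
        using k [OF z] \<beta> [OF z r(3)] by simp
      then have "of_real (\<beta> z * S 0 r) = (of_real k :: complex)" by simp
      then have "\<beta> z * S 0 r = k" by (simp only: of_real_eq_iff)
      then show "\<beta> z = k / S 0 r" using r by (simp add: field_simps)
    qed
  qed
  have "h1 (w, z) = 0 \<and> h2 (w, z) = \<i> * of_real b * z" if w: "w \<in> ball 0 R" and z: "z \<in> ball 0 R" for w z
  proof (cases "z = 0")
    case True
    have "\<forall>\<^sub>F z' in at 0. h1 (w, z') = 0" using near0 by eventually_elim (use \<beta> w in blast)
    from Lim_transform_eventually [OF lim0 [OF h1_2 [OF w]] this]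
    have "h1 (w, 0) = 0" using LIM_const_eq by metis
    then show ?thesis using True g w by simp
  next
    case False
    then show ?thesis using \<beta> [of z w] b [of z] w z by (simp add: field_simps)
  qed
  then show ?thesis by blast
qed

end

section \<open>Wirtinger derivatives of radial functions and holomorphic slices\<close>

lemma eventually_nhds_Pair_0_imp_ball:
  fixes Pr :: "'a::real_normed_vector \<times> 'b::real_normed_vector \<Rightarrow> bool"
  assumes "\<forall>\<^sub>F x in nhds (0, 0). Pr x"
  shows "\<exists>e>0. \<forall>a b. norm a < e \<longrightarrow> norm b < e \<longrightarrow> Pr (a, b)"
proof -
  from assms obtain d where d: "d > 0" "\<And>x. dist x (0, 0) < d \<Longrightarrow> Pr x"
    unfolding eventually_nhds_metric by blast
  have "Pr (a, b)" if "norm a < d / 2" "norm b < d / 2" for a b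
    using d(2) [of "(a, b)"] norm_Pair_le [of a b] that by (simp add: dist_norm zero_prod_def [symmetric])
  then show ?thesis using d(1) by (intro exI [of _ "d / 2"]) auto
qed

lemma wirtinger_of_real:
  assumes "(f has_derivative f') (at z)"
  shows "wirtinger (\<lambda>w. of_real (f w)) z = (of_real (f' 1) - \<i> * of_real (f' \<i>)) / 2"
proof -
  have "((\<lambda>w. complex_of_real (f w)) has_derivative (\<lambda>v. of_real (f' v))) (at z)"
    using assms by (rule has_derivative_of_real)
  then show ?thesis
    by (simp only: wirtinger_def frechet_derivative_at [symmetric])
qed

text \<open>
  For a radial function \<open>z f\<^bsub>z\<^esub> = (r / 2) (d f / d r)\<close> is real. Differentiability is needed only on the positive
  real axis.
\<close>
lemma mult_wirtinger_radial:
  fixes f :: "complex \<Rightarrow> real"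
  assumes z: "z \<noteq> 0" and rad: "\<forall>\<^sub>F w in nhds z. f w = f (of_real (norm w))"
    and f: "(f has_derivative f') (at (of_real (norm z)))"
  shows "z * wirtinger (\<lambda>w. of_real (f w)) z = of_real (norm z * f' 1) / 2"
proof -
  have "((\<lambda>w. f (of_real (norm w))) has_derivative (\<lambda>v. f' (of_real (v \<bullet> sgn z)))) (at z)"
    by (rule has_derivative_compose [OF has_derivative_of_real [OF has_derivative_norm [OF z]] f])
  then have "(f has_derivative (\<lambda>v. f' (of_real (v \<bullet> sgn z)))) (at z)"
    by (rule has_derivative_transform_eventually)
      (use rad eventually_nhds_x_imp_x [OF rad] in \<open>auto simp: eventually_at_filter elim!: eventually_mono\<close>)
  note wirt = wirtinger_of_real [OF this]
  have "f' (of_real x) = x * f' 1" for x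
    using linear_cmul [OF has_derivative_linear [OF f], of x 1] by (simp add: of_real_def)
  then have "wirtinger (\<lambda>w. of_real (f w)) z = of_real (f' 1) * cnj (sgn z) / 2"
    unfolding wirt by (simp add: inner_complex_def complex_eq_iff del: Re_sgn Im_sgn)
  moreover have "z * cnj (sgn z) = of_real (norm z)"
    using z complex_norm_square [of z]
    by (simp add: sgn_div_norm scaleR_conv_of_real divide_simps power2_eq_square)
  ultimately show ?thesis by (simp add: mult_ac)
qed

lemma holomorphic2_on_slices:
  assumes f: "holomorphic2_on f U" and sub: "ball 0 R \<times> ball 0 R \<subseteq> U"
  shows "z \<in> ball 0 R \<Longrightarrow> (\<lambda>w. f (w, z)) holomorphic_on ball 0 R"
    and "w \<in> ball 0 R \<Longrightarrow> (\<lambda>z. f (w, z)) holomorphic_on ball 0 R"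
proof -
  have deriv: "\<exists>a b. (f has_derivative (\<lambda>v. a * fst v + b * snd v)) (at (w, z))"
    if "w \<in> ball 0 R" "z \<in> ball 0 R" for w z
    using f sub that unfolding holomorphic2_on_def by blast
  show "(\<lambda>w. f (w, z)) holomorphic_on ball 0 R" if z: "z \<in> ball 0 R"
    unfolding holomorphic_on_open [OF open_ball]
  proof
    fix w :: complex assume "w \<in> ball 0 R"
    with deriv z obtain a b where d: "(f has_derivative (\<lambda>v. a * fst v + b * snd v)) (at (w, z))"
      by blast
    have "((\<lambda>w. (w, z)) has_derivative (\<lambda>v. (v, 0))) (at w)" by (auto intro!: derivative_eq_intros)
    from has_derivative_compose [OF this d] show "\<exists>a. ((\<lambda>w. f (w, z)) has_field_derivative a) (at w)"
      by (auto simp: has_field_derivative_def)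
  qed
  show "(\<lambda>z. f (w, z)) holomorphic_on ball 0 R" if w: "w \<in> ball 0 R"
    unfolding holomorphic_on_open [OF open_ball]
  proof
    fix z :: complex assume "z \<in> ball 0 R"
    with deriv w obtain a b where d: "(f has_derivative (\<lambda>v. a * fst v + b * snd v)) (at (w, z))"
      by blast
    have "((\<lambda>z. (w, z)) has_derivative (\<lambda>v. (0, v))) (at z)" by (auto intro!: derivative_eq_intros)
    from has_derivative_compose [OF this d] show "\<exists>a. ((\<lambda>z. f (w, z)) has_field_derivative a) (at z)"
      by (auto simp: has_field_derivative_def)
  qed
qed

section \<open>The hypersurface\<close>

text \<open>
  The hypersurface, with one radius \<open>\<epsilon>\<close> on which the equation, differentiability, symmetry and positivity hold;
  flatness refers to the germ at \<open>0\<close>. The maps \<open>dP\<close> and \<open>dQ\<close> are the Frechet derivatives; only \<open>dQ\<close> needs to be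
  continuous, and only at the origin.
\<close>
locale radial_hypersurface =
  fixes \<rho> :: "complex \<times> complex \<Rightarrow> real" and P :: "complex \<Rightarrow> real" and Q :: "complex \<times> real \<Rightarrow> real"
    and dP :: "complex \<Rightarrow> complex \<Rightarrow>\<^sub>L real" and dQ :: "complex \<times> real \<Rightarrow> (complex \<times> real) \<Rightarrow>\<^sub>L real"
    and \<epsilon> :: real
  assumes \<epsilon>: "\<epsilon> > 0"
    and rho: "\<lbrakk>norm w < \<epsilon>; norm z < \<epsilon>\<rbrakk> \<Longrightarrow> \<rho> (w, z) = Re w + P z + Im w * Q (z, Im w)"
    and P_deriv: "norm z < \<epsilon> \<Longrightarrow> (P has_derivative blinfun_apply (dP z)) (at z)"
    and Q_deriv: "\<lbrakk>norm z < \<epsilon>; \<bar>t\<bar> < \<epsilon>\<rbrakk> \<Longrightarrow> (Q has_derivative blinfun_apply (dQ (z, t))) (at (z, t))"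
    and dQ_cont: "isCont dQ (0, 0)"
    and P_radial: "norm z < \<epsilon> \<Longrightarrow> P z = P (of_real (norm z))"
    and Q_radial: "\<lbrakk>norm z < \<epsilon>; \<bar>t\<bar> < \<epsilon>\<rbrakk> \<Longrightarrow> Q (z, t) = Q (of_real (norm z), t)"
    and Q_0: "Q (0, 0) = 0"
    and P_pos: "\<lbrakk>z \<noteq> 0; norm z < \<epsilon>\<rbrakk> \<Longrightarrow> P z > 0"
    and P_flat: "flat_at_0 (\<lambda>w. of_real (P w))"
    and P'_flat: "flat_at_0 (wirtinger (\<lambda>w. of_real (P w)))"
begin

text \<open>The profile of \<open>P\<close> as a function of the radius, and its derivative.\<close>

definition p :: "real \<Rightarrow> real" where "p r = P (of_real r)"

definition p' :: "real \<Rightarrow> real" where "p' r = dP (of_real r) 1"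

text \<open>
  In terms of \<open>r = \<bar>z\<^sub>2\<bar>\<close> and \<open>t = Im z\<^sub>1\<close>, the Wirtinger derivatives of \<open>\<rho>\<close> are \<open>\<rho>\<^bsub>z1\<^esub> = normal r t / 2\<close> and
  \<open>z\<^sub>2 \<rho>\<^bsub>z2\<^esub> = slope r t / 2\<close>, and \<open>point r t\<close> is the value of \<open>z\<^sub>1\<close> on the hypersurface.
\<close>

definition normal :: "real \<Rightarrow> real \<Rightarrow> complex" where
  "normal r t = 1 - \<i> * of_real (Q (of_real r, t) + t * dQ (of_real r, t) (0, 1))"

definition slope :: "real \<Rightarrow> real \<Rightarrow> real" where
  "slope r t = r * (p' r + t * dQ (of_real r, t) (1, 0))"

definition point :: "real \<Rightarrow> real \<Rightarrow> complex" where
  "point r t = \<i> * of_real t - of_real (p r + t * Q (of_real r, t))"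

lemma rho_radial:
  assumes w: "norm w < \<epsilon>" and z: "norm z < \<epsilon>"
  shows "\<rho> (w, z) = Re w + p (norm z) + Im w * Q (of_real (norm z), Im w)"
proof -
  have t: "\<bar>Im w\<bar> < \<epsilon>" using abs_Im_le_cmod [of w] w by linarith
  show ?thesis
    by (simp only: rho [OF w z] p_def P_radial [OF z, symmetric] Q_radial [OF z t, symmetric])
qed

lemma rho_point:
  assumes "norm (point r t) < \<epsilon>" "norm z = r" "r < \<epsilon>"
  shows "\<rho> (point r t, z) = 0"
proof -
  have "Re (point r t) = - (p r + t * Q (of_real r, t))" "Im (point r t) = t"
    by (simp_all add: point_def)
  then show ?thesis using rho_radial [OF assms(1), of z] assms(2,3) by simp
qed

lemma wirtinger1_rho:
  assumes w: "norm w < \<epsilon>" and z: "norm z < \<epsilon>"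
  shows "wirtinger1 \<rho> (w, z) = normal (norm z) (Im w) / 2"
proof -
  define c :: complex where "c = of_real (norm z)"
  define t where "t = Im w"
  have t: "\<bar>t\<bar> < \<epsilon>" using w abs_Im_le_cmod [of w] by (simp add: t_def)
  have c: "norm c < \<epsilon>" using z by (simp add: c_def)
  have "((\<lambda>w. (c, Im w)) has_derivative (\<lambda>v. (0, Im v))) (at w)"
    by (auto intro!: derivative_eq_intros)
  then have Q: "((\<lambda>w. Q (c, Im w)) has_derivative (\<lambda>v. dQ (c, t) (0, Im v))) (at w)"
    unfolding t_def by (rule has_derivative_compose) (use Q_deriv [OF c t] in \<open>simp add: t_def\<close>)
  have "((\<lambda>w. Re w + p (norm z) + Im w * Q (c, Im w)) has_derivative
      (\<lambda>v. Re v + 0 + (Im w * dQ (c, t) (0, Im v) + Im v * Q (c, Im w)))) (at w)"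
    by (intro has_derivative_add has_derivative_mult has_derivative_const Q
        bounded_linear_imp_has_derivative bounded_linear_Re bounded_linear_Im)
  then have "((\<lambda>w. \<rho> (w, z)) has_derivative
      (\<lambda>v. Re v + 0 + (Im w * dQ (c, t) (0, Im v) + Im v * Q (c, Im w)))) (at w)"
    by (rule has_derivative_transform_within_open [of _ _ _ _ "ball 0 \<epsilon>"])
      (use w z rho_radial in \<open>auto simp: c_def\<close>)
  from wirtinger_of_real [OF this] show ?thesis
    using blinfun.zero_right [of "dQ (c, t)"]
    by (simp add: wirtinger1_def normal_def c_def t_def zero_prod_def add.commute)
qed

lemma wirtinger2_rho:
  assumes w: "norm w < \<epsilon>" and z: "norm z < \<epsilon>" "z \<noteq> 0"
  shows "z * wirtinger2 \<rho> (w, z) = of_real (slope (norm z) (Im w)) / 2"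
proof -
  define c :: complex where "c = of_real (norm z)"
  define t where "t = Im w"
  have t: "\<bar>t\<bar> < \<epsilon>" using w abs_Im_le_cmod [of w] by (simp add: t_def)
  have c: "norm c < \<epsilon>" using z by (simp add: c_def)
  have "((\<lambda>z. (z, t)) has_derivative (\<lambda>v. (v, 0))) (at c)"
    by (auto intro!: derivative_eq_intros)
  then have Q: "((\<lambda>z. Q (z, t)) has_derivative (\<lambda>v. dQ (c, t) (v, 0))) (at c)"
    by (rule has_derivative_compose) (use Q_deriv [OF c t] in simp)
  have "((\<lambda>z. Re w + P z + t * Q (z, t)) has_derivative
      (\<lambda>v. 0 + dP c v + t * dQ (c, t) (v, 0))) (at c)"
    by (intro has_derivative_add has_derivative_mult_right has_derivative_const Q P_deriv c)
  then have "((\<lambda>z. \<rho> (w, z)) has_derivative (\<lambda>v. 0 + dP c v + t * dQ (c, t) (v, 0))) (at c)"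
    by (rule has_derivative_transform_within_open [of _ _ _ _ "ball 0 \<epsilon>"])
      (use w c rho in \<open>auto simp: t_def\<close>)
  moreover have "\<forall>\<^sub>F z' in nhds z. \<rho> (w, z') = \<rho> (w, of_real (norm z'))"
    using eventually_nhds_in_open [OF open_ball, of z 0 \<epsilon>] z
    by (auto elim!: eventually_mono simp: rho_radial w)
  ultimately have "z * wirtinger (\<lambda>z. of_real (\<rho> (w, z))) z =
      of_real (norm z * (0 + dP c 1 + t * dQ (c, t) (1, 0))) / 2"
    unfolding c_def by (intro mult_wirtinger_radial [OF z(2)])
  then show ?thesis by (simp add: wirtinger2_def slope_def p'_def c_def t_def)
qed

sublocale flat_profile p p'
proof
  have near: "\<forall>\<^sub>F r in at_right 0. 0 < r \<and> r < \<epsilon>"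
    using \<epsilon> by (auto simp: eventually_at_right_field)
  show "\<forall>\<^sub>F r in at_right 0. (p has_real_derivative p' r) (at r)"
    using near
  proof eventually_elim
    case (elim r)
    have "((\<lambda>r. complex_of_real r) has_derivative complex_of_real) (at r)"
      by (intro bounded_linear_imp_has_derivative bounded_linear_of_real)
    from has_derivative_compose [OF this P_deriv]
    have "(p has_derivative (\<lambda>x. dP (of_real r) (of_real x))) (at r)"
      using elim by (simp add: p_def [abs_def])
    moreover have "dP (of_real r) (of_real x) = p' r * x" for x
      using blinfun.scaleR_right [of "dP (of_real r)" x 1] by (simp add: p'_def of_real_def)
    ultimately show ?case by (simp add: has_field_derivative_def)
  qed
  show "\<forall>\<^sub>F r in at_right 0. p r > 0"
    using near by eventually_elim (simp add: p_def P_pos)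
  show "\<exists>C. \<forall>\<^sub>F r in at_right 0. p r \<le> C * r ^ n" for n
  proof -
    obtain C e where e: "e > 0" and C: "\<And>z. norm z < e \<Longrightarrow> norm (complex_of_real (P z)) \<le> C * norm z ^ n"
      using P_flat unfolding flat_at_0_def by meson
    have "p r \<le> C * r ^ n" if "0 < r" "r < e" for r
      using C [of "of_real r"] that by (simp add: p_def)
    then show ?thesis using e by (auto simp: eventually_at_right_field)
  qed
  show "\<exists>C. \<forall>\<^sub>F r in at_right 0. \<bar>p' r\<bar> \<le> C * r\<^sup>2"
  proof -
    obtain C e where e: "e > 0"
      and C: "\<And>z. norm z < e \<Longrightarrow> norm (wirtinger (\<lambda>w. of_real (P w)) z) \<le> C * norm z ^ 2"
      using P'_flat unfolding flat_at_0_def by meson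
    have "\<bar>p' r\<bar> \<le> (2 * C) * r\<^sup>2" if r: "0 < r" "r < min \<epsilon> e" for r
    proof -
      have rad: "\<forall>\<^sub>F z in nhds (of_real r). P z = P (of_real (norm z))"
      proof -
        have "of_real r \<in> ball (0::complex) \<epsilon>" using r by simp
        from eventually_nhds_in_open [OF open_ball this] show ?thesis
          by eventually_elim (rule P_radial, simp)
      qed
      have "of_real r * wirtinger (\<lambda>w. of_real (P w)) (of_real r) = of_real (r * p' r) / 2"
        using mult_wirtinger_radial [OF _ rad, of "dP (of_real r)"] P_deriv [of "of_real r"] r
        by (simp add: p'_def)
      then have "wirtinger (\<lambda>w. of_real (P w)) (of_real r) = of_real (p' r / 2)"
        using r by simp
      then have "norm (wirtinger (\<lambda>w. of_real (P w)) (of_real r)) = \<bar>p' r\<bar> / 2"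
        by (simp only: norm_of_real)
      then show ?thesis using C [of "of_real r"] r by simp
    qed
    then have "\<forall>\<^sub>F r in at_right 0. \<bar>p' r\<bar> \<le> (2 * C) * r\<^sup>2"
      unfolding eventually_at_right_field using e \<epsilon> by (intro exI [of _ "min \<epsilon> e"]) simp
    then show ?thesis ..
  qed
qed

text \<open>
  The curves in the hypersurface are \<open>t = \<alpha> p r\<close>: along these \<open>z\<^sub>1 / p r\<close> tends to \<open>\<i> \<alpha> - 1\<close>, a point that
  moves with \<open>\<alpha>\<close>.
\<close>
lemma approach:
  "((\<lambda>r. (complex_of_real r, \<alpha> * p r)) \<longlongrightarrow> (0, 0)) (at_right 0)"
proof -
  have "((\<lambda>r. (complex_of_real r, \<alpha> * p r)) \<longlongrightarrow> (of_real 0, \<alpha> * 0)) (at_right 0)"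
    by (intro tendsto_intros p_tendsto_0)
  then show ?thesis by simp
qed

lemma Q_approach: "((\<lambda>r. Q (of_real r, \<alpha> * p r)) \<longlongrightarrow> 0) (at_right 0)"
proof -
  have "isCont Q (0, 0)"
    using Q_deriv [of 0 0] \<epsilon> has_derivative_continuous by fastforce
  from isCont_tendsto_compose [OF this approach] show ?thesis by (simp add: Q_0)
qed

lemma dQ_approach: "((\<lambda>r. dQ (of_real r, \<alpha> * p r) v) \<longlongrightarrow> dQ (0, 0) v) (at_right 0)"
  by (intro tendsto_intros isCont_tendsto_compose [OF dQ_cont approach])

sublocale tangency_curves p p' "\<lambda>\<alpha> r. point r (\<alpha> * p r)"
  "\<lambda>\<alpha> r. normal r (\<alpha> * p r)" "\<lambda>\<alpha> r. slope r (\<alpha> * p r)"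
proof
  fix \<alpha>
  have "((\<lambda>r. \<i> * of_real \<alpha> - 1 - of_real (\<alpha> * Q (of_real r, \<alpha> * p r)))
      \<longlongrightarrow> \<i> * of_real \<alpha> - 1 - of_real (\<alpha> * 0)) (at_right 0)"
    by (intro tendsto_intros Q_approach)
  moreover have "\<forall>\<^sub>F r in at_right 0. \<i> * of_real \<alpha> - 1 - of_real (\<alpha> * Q (of_real r, \<alpha> * p r)) =
      point r (\<alpha> * p r) / of_real (p r)"
    using pos by eventually_elim (simp add: point_def field_simps)
  ultimately show "((\<lambda>r. point r (\<alpha> * p r) / of_real (p r)) \<longlongrightarrow> \<i> * of_real \<alpha> - 1) (at_right 0)"
    by (simp add: Lim_transform_eventually)
  have "((\<lambda>r. normal r (\<alpha> * p r)) \<longlongrightarrow>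
      1 - \<i> * of_real (0 + \<alpha> * 0 * dQ (0, 0) (0, 1))) (at_right 0)"
    unfolding normal_def by (intro tendsto_intros Q_approach dQ_approach p_tendsto_0)
  then show "((\<lambda>r. normal r (\<alpha> * p r)) \<longlongrightarrow> 1) (at_right 0)" by simp
  have "((\<lambda>r. r * (\<alpha> * dQ (of_real r, \<alpha> * p r) (1, 0))) \<longlongrightarrow> 0 * (\<alpha> * dQ (0, 0) (1, 0))) (at_right 0)"
    by (intro tendsto_intros dQ_approach)
  moreover have "\<forall>\<^sub>F r in at_right 0. r * (\<alpha> * dQ (of_real r, \<alpha> * p r) (1, 0)) =
      (slope r (\<alpha> * p r) - r * p' r) / p r"
    using pos by eventually_elim (simp add: slope_def field_simps)
  ultimately show "((\<lambda>r. (slope r (\<alpha> * p r) - r * p' r) / p r) \<longlongrightarrow> 0) (at_right 0)"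
    by (simp add: Lim_transform_eventually)
  show "\<forall>\<^sub>F r in at_right 0. slope r (0 * p r) = r * p' r"
    by (simp add: slope_def)
qed

lemma tangent_rotation:
  "tangent_near (\<lambda>(z1, z2). (0, \<i> * of_real \<beta> * z2)) \<rho> (0, 0)"
proof -
  have "Re (\<i> * of_real \<beta> * z * wirtinger2 \<rho> (w, z)) = 0" if "norm w < \<epsilon>" "norm z < \<epsilon>" for w z
  proof (cases "z = 0")
    case False
    have "\<i> * of_real \<beta> * z * wirtinger2 \<rho> (w, z) = \<i> * of_real (\<beta> * slope (norm z) (Im w) / 2)"
      using wirtinger2_rho [OF that False] by (simp add: mult.assoc)
    then show ?thesis by (simp only: Re_i_times Im_complex_of_real minus_zero)
  qed simp
  moreover have "\<forall>\<^sub>F x in nhds (0, 0). x \<in> ball (0::complex) \<epsilon> \<times> ball (0::complex) \<epsilon>"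
    by (rule eventually_nhds_in_open) (use \<epsilon> in \<open>auto intro: open_Times\<close>)
  ultimately show ?thesis
    unfolding tangent_near_def by (auto elim!: eventually_mono)
qed

lemma tangent_imp_rotation:
  assumes hol: "holomorphic_vfield_near H (0, 0)" and H0: "H (0, 0) = 0"
    and tan: "tangent_near H \<rho> (0, 0)"
  shows "\<exists>\<beta>::real. \<forall>\<^sub>F x in nhds (0, 0). H x = (0, \<i> * of_real \<beta> * snd x)"
proof -
  obtain U where U: "open U" "(0, 0) \<in> U"
    and h1: "holomorphic2_on (\<lambda>z. fst (H z)) U" and h2: "holomorphic2_on (\<lambda>z. snd (H z)) U"
    using hol unfolding holomorphic_vfield_near_def by blast
  obtain R where R: "R > 0" and sub: "ball 0 R \<times> ball 0 R \<subseteq> U"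
    using eventually_nhds_Pair_0_imp_ball [OF eventually_nhds_in_open [OF U]] by fastforce
  obtain d where d: "d > 0" and D: "\<And>w z. norm w < d \<Longrightarrow> norm z < d \<Longrightarrow> \<rho> (w, z) = 0 \<Longrightarrow>
      Re (fst (H (w, z)) * wirtinger1 \<rho> (w, z) + snd (H (w, z)) * wirtinger2 \<rho> (w, z)) = 0"
    using eventually_nhds_Pair_0_imp_ball [OF tan [unfolded tangent_near_def]] by blast
  have "\<exists>\<beta>::real. \<forall>w\<in>ball 0 R. \<forall>z\<in>ball 0 R. fst (H (w, z)) = 0 \<and> snd (H (w, z)) = \<i> * of_real \<beta> * z"
  proof (rule tangency_rigidity [OF R])
    fix \<alpha>
    have "\<forall>\<^sub>F r in at_right 0. 0 < r \<and> r < min d \<epsilon>"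
      using d \<epsilon> by (auto simp: eventually_at_right_field intro!: exI [of _ "min d \<epsilon>"])
    moreover have "\<forall>\<^sub>F r in at_right 0. point r (\<alpha> * p r) \<in> ball 0 (min d \<epsilon>)"
      using W_in_ball [of "min d \<epsilon>"] d \<epsilon> by simp
    ultimately show "\<forall>\<^sub>F r in at_right 0. \<forall>z. norm z = r \<longrightarrow>
      Re (fst (H (point r (\<alpha> * p r), z)) * normal r (\<alpha> * p r) +
          snd (H (point r (\<alpha> * p r), z)) * of_real (slope r (\<alpha> * p r)) / z) = 0"
    proof eventually_elim
      case (elim r)
      show ?case
      proof (intro allI impI)
        fix z :: complex assume z: "norm z = r"
        define w where "w = point r (\<alpha> * p r)"
        have w: "norm w < d" "norm w < \<epsilon>" and z': "norm z < d" "norm z < \<epsilon>" "z \<noteq> 0"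
          using elim z by (auto simp: w_def)
        have im: "Im w = \<alpha> * p r" by (simp add: w_def point_def)
        have "\<rho> (w, z) = 0" using rho_point w z z' by (simp add: w_def)
        from D [OF w(1) z'(1) this]
        have "Re (fst (H (w, z)) * wirtinger1 \<rho> (w, z) + snd (H (w, z)) * wirtinger2 \<rho> (w, z)) = 0" .
        moreover have "wirtinger2 \<rho> (w, z) = of_real (slope r (\<alpha> * p r)) / (2 * z)"
          using wirtinger2_rho [OF w(2) z'(2,3)] z'(3) z im by (simp add: field_simps)
        moreover have "wirtinger1 \<rho> (w, z) = normal r (\<alpha> * p r) / 2"
          using wirtinger1_rho [OF w(2) z'(2)] z im by simp
        ultimately have "Re ((fst (H (w, z)) * normal r (\<alpha> * p r) +
            snd (H (w, z)) * of_real (slope r (\<alpha> * p r)) / z) / of_real 2) = 0"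
          by (simp add: add_divide_distrib mult.commute)
        then show "Re (fst (H (point r (\<alpha> * p r), z)) * normal r (\<alpha> * p r) +
            snd (H (point r (\<alpha> * p r), z)) * of_real (slope r (\<alpha> * p r)) / z) = 0"
          unfolding w_def by (simp only: Re_divide_of_real)
      qed
    qed
  qed (use holomorphic2_on_slices [OF h1 sub] holomorphic2_on_slices [OF h2 sub] H0 in auto)
  then obtain \<beta> :: real where \<beta>: "\<And>w z. w \<in> ball 0 R \<Longrightarrow> z \<in> ball 0 R \<Longrightarrow>
      H (w, z) = (0, \<i> * of_real \<beta> * z)"
    by (metis prod.collapse)
  have "\<forall>\<^sub>F x in nhds (0, 0). x \<in> ball (0::complex) R \<times> ball (0::complex) R"
    by (rule eventually_nhds_in_open) (use R in \<open>auto intro: open_Times\<close>)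
  then have "\<forall>\<^sub>F x in nhds (0, 0). H x = (0, \<i> * of_real \<beta> * snd x)"
    by eventually_elim (auto simp: \<beta>)
  then show ?thesis by blast
qed

theorem hol0_eq:
  "hol0 \<rho> (0, 0) = {vfield_germ (0, 0) (\<lambda>(z1, z2). (0, \<i> * of_real \<beta> * z2)) |\<beta>::real. True}"
proof (intro equalityI subsetI)
  fix X assume "X \<in> hol0 \<rho> (0, 0)"
  then obtain H where X: "X = vfield_germ (0, 0) H" and H: "holomorphic_vfield_near H (0, 0)"
      "H (0, 0) = 0" "tangent_near H \<rho> (0, 0)"
    unfolding hol0_def by blast
  from tangent_imp_rotation [OF H] obtain \<beta> :: real
    where \<beta>: "\<forall>\<^sub>F x in nhds (0, 0). H x = (0, \<i> * of_real \<beta> * snd x)" by blast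
  have "X = vfield_germ (0, 0) (\<lambda>(z1, z2). (0, \<i> * of_real \<beta> * z2))"
    unfolding X vfield_germ_def
  proof (intro Collect_cong iffI)
    fix G :: vfield
    show "\<forall>\<^sub>F z in nhds (0, 0). G z = (case z of (z1, z2) \<Rightarrow> (0, \<i> * of_real \<beta> * z2))"
      if "\<forall>\<^sub>F z in nhds (0, 0). G z = H z"
      using that \<beta> by eventually_elim (auto split: prod.split)
    show "\<forall>\<^sub>F z in nhds (0, 0). G z = H z"
      if "\<forall>\<^sub>F z in nhds (0, 0). G z = (case z of (z1, z2) \<Rightarrow> (0, \<i> * of_real \<beta> * z2))"
      using that \<beta> by eventually_elim (auto split: prod.splits)
  qed
  then show "X \<in> {vfield_germ (0, 0) (\<lambda>(z1, z2). (0, \<i> * of_real \<beta> * z2)) |\<beta>::real. True}"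
    by blast
next
  fix X assume "X \<in> {vfield_germ (0, 0) (\<lambda>(z1, z2). (0, \<i> * of_real \<beta> * z2)) |\<beta>::real. True}"
  then obtain \<beta> :: real where X: "X = vfield_germ (0, 0) (\<lambda>(z1, z2). (0, \<i> * of_real \<beta> * z2))"
    by blast
  have "holomorphic_vfield_near (\<lambda>(z1, z2). (0, \<i> * of_real \<beta> * z2)) (0, 0)"
    unfolding holomorphic_vfield_near_def holomorphic2_on_def
  proof (intro exI [of _ UNIV] conjI ballI)
    fix z :: "complex \<times> complex"
    show "\<exists>a b. ((\<lambda>z. fst (case z of (z1, z2) \<Rightarrow> (0, \<i> * of_real \<beta> * z2))) has_derivative
        (\<lambda>v. a * fst v + b * snd v)) (at z)"
      by (intro exI [of _ 0]) (simp add: case_prod_beta)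
    show "\<exists>a b. ((\<lambda>z. snd (case z of (z1, z2) \<Rightarrow> (0, \<i> * of_real \<beta> * z2))) has_derivative
        (\<lambda>v. a * fst v + b * snd v)) (at z)"
      by (rule exI [of _ 0], rule exI [of _ "\<i> * of_real \<beta>"])
        (auto simp: case_prod_beta intro!: derivative_eq_intros)
  qed auto
  then show "X \<in> hol0 \<rho> (0, 0)"
    unfolding X hol0_def using tangent_rotation [of \<beta>] by (fastforce simp: zero_prod_def)
qed

end

theorem corollary1:
  fixes P :: "complex \<Rightarrow> real"
    and Q :: "complex \<times> real \<Rightarrow> real"
    and \<rho> :: "complex \<times> complex \<Rightarrow> real"
  assumes rho: "\<forall>\<^sub>F z in nhds (0, 0).
      \<rho> z = Re (fst z) + P (snd z) + Im (fst z) * Q (snd z, Im (fst z))"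
    and P_C1: "C1_near P 0"
    and Q_C1: "C1_near Q (0, 0)"
    and P_0: "P 0 = 0"
    and Q_0: "Q (0, 0) = 0"
    and P_radial: "\<forall>\<^sub>F w in nhds 0. P w = P (of_real (norm w))"
    and Q_radial: "\<forall>\<^sub>F (w, t) in nhds (0, 0). Q (w, t) = Q (of_real (norm w), t)"
    and P_pos: "\<forall>\<^sub>F w in at 0. P w > 0"
    and P_flat: "flat_at_0 (\<lambda>w. of_real (P w))"
    and P'_flat: "flat_at_0 (wirtinger (\<lambda>w. of_real (P w)))"
  shows "hol0 \<rho> (0, 0) = {vfield_germ (0, 0) (\<lambda>(z1, z2). (0, \<i> * of_real \<beta> * z2)) |\<beta>::real. True}"
proof -
  obtain U dP where U: "open U" "0 \<in> U"
    and dP: "\<And>z. z \<in> U \<Longrightarrow> (P has_derivative blinfun_apply (dP z)) (at z)"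
    using P_C1 unfolding C1_near_def by blast
  obtain V dQ where V: "open V" "(0, 0) \<in> V"
    and dQ: "\<And>x. x \<in> V \<Longrightarrow> (Q has_derivative blinfun_apply (dQ x)) (at x)"
    and dQ_cont: "continuous_on V dQ"
    using Q_C1 unfolding C1_near_def by blast
  have "\<forall>\<^sub>F z in nhds 0. z \<in> U \<and> P z = P (of_real (norm z)) \<and> (z \<noteq> 0 \<longrightarrow> P z > 0)"
    using eventually_nhds_in_open [OF U] P_radial P_pos [unfolded eventually_at_filter]
    by eventually_elim auto
  then obtain e1 where e1: "e1 > 0" "\<And>z. norm z < e1 \<Longrightarrow>
      z \<in> U \<and> P z = P (of_real (norm z)) \<and> (z \<noteq> 0 \<longrightarrow> P z > 0)"
    unfolding eventually_nhds_metric by (auto simp: dist_norm)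
  have "\<forall>\<^sub>F x in nhds (0, 0). x \<in> V \<and> Q x = Q (of_real (norm (fst x)), snd x)"
    using eventually_nhds_in_open [OF V] Q_radial by eventually_elim auto
  from eventually_nhds_Pair_0_imp_ball [OF this] obtain e2 where e2: "e2 > 0"
    "\<And>z t. norm z < e2 \<Longrightarrow> norm t < e2 \<Longrightarrow> (z, t) \<in> V \<and> Q (z, t) = Q (of_real (norm z), t)"
    by auto
  from eventually_nhds_Pair_0_imp_ball [OF rho] obtain e3 where e3: "e3 > 0"
    "\<And>w z. norm w < e3 \<Longrightarrow> norm z < e3 \<Longrightarrow> \<rho> (w, z) = Re w + P z + Im w * Q (z, Im w)"
    by auto
  interpret radial_hypersurface \<rho> P Q dP dQ "min e1 (min e2 e3)"
  proof
    show "isCont dQ (0, 0)"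
      using dQ_cont V by (simp add: continuous_on_eq_continuous_at)
    show "P z = P (of_real (norm z))" if "norm z < min e1 (min e2 e3)" for z
      using e1(2) [of z] that by auto
    show "Q (z, t) = Q (of_real (norm z), t)"
      if "norm z < min e1 (min e2 e3)" "\<bar>t\<bar> < min e1 (min e2 e3)" for z t
      using e2(2) [of z t] that by auto
    show "(P has_derivative blinfun_apply (dP z)) (at z)" if "norm z < min e1 (min e2 e3)" for z
      using e1(2) [of z] that by (intro dP) auto
    show "(Q has_derivative blinfun_apply (dQ (z, t))) (at (z, t))"
      if "norm z < min e1 (min e2 e3)" "\<bar>t\<bar> < min e1 (min e2 e3)" for z t
      using e2(2) [of z t] that by (intro dQ) auto
    show "0 < P z" if "z \<noteq> 0" "norm z < min e1 (min e2 e3)" for z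
      using e1(2) [of z] that by auto
  qed (use e1(1) e2(1) e3 Q_0 P_flat P'_flat in auto)
  show ?thesis by (rule hol0_eq)
qed

end
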